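(* Let $\mathcal{H}_1,\mathcal{H}_2$ be complex Hilbert spaces, let $B\in\mathcal{B}(\mathcal{H}_2,\mathcal{H}_1)$, $C\in\mathcal{B}(\mathcal{H}_1,\mathcal{H}_2)$, and let $\mathbb{T}=\begin{bmatrix}0&B\\ C&0\end{bmatrix}\in\mathcal{B}(\mathcal{H}_1\oplus\mathcal{H}_2)$. Let $r\ge 1$ and let $f,g$ be non-negative continuous functions on $[0,\infty)$ satisfying $f(t)g(t)=t$ for all $t\ge0$. Then $$\omega^r(\mathbb{T})\le 2^{r-2}\,\omega^{\frac12}\left(f^{2r}(|B|)+g^{2r}(|C^*|)\right)\,\omega^{\frac12}\left(f^{2r}(|C|)+g^{2r}(|B^*|)\right).$$
   Context: $\mathcal{B}(\cdot,\cdot)$ and $\mathcal{B}(\cdot)$ denote spaces of bounded linear operators. The numerical radius of a bounded operator $A$ on a complex Hilbert space is $\omega(A)=\sup_{\|x\|=1}|\langle Ax,x\rangle|$, and $\omega^s(A)=(\omega(A))^s$. $|A|=(A^*A)^{1/2}$. For a positive operator $P$, $f^{s}(P)=(f(P))^{s}$ is defined by the continuous functional calculus. *)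

theory Defs
  imports "HOL-Analysis.Analysis" "HOL-Computational_Algebra.Polynomial"
begin

section \<open>Complex Hilbert spaces\<close>

text \<open>
  The norm and its completeness are inherited from the real structure, whose inner product is the
  real part of the complex one; hence \<open>norm x = sqrt (Re (cinner x x))\<close>, and \<open>cinner x x\<close> is
  real by conjugate symmetry. The complex inner product is linear in its first argument.
  The zero space is allowed.
\<close>

class complex_hilbert_space = real_inner + banach +
  fixes scaleC :: "complex \<Rightarrow> 'a \<Rightarrow> 'a" (infixr \<open>*\<^sub>C\<close> 75)
    and cinner :: "'a \<Rightarrow> 'a \<Rightarrow> complex"
  assumes scaleC_add_right: "a *\<^sub>C (x + y) = a *\<^sub>C x + a *\<^sub>C y"
    and scaleC_add_left: "(a + b) *\<^sub>C x = a *\<^sub>C x + b *\<^sub>C x"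
    and scaleC_scaleC: "a *\<^sub>C b *\<^sub>C x = (a * b) *\<^sub>C x"
    and scaleR_scaleC: "r *\<^sub>R x = complex_of_real r *\<^sub>C x"
    and cinner_commute: "cinner x y = cnj (cinner y x)"
    and cinner_add_left: "cinner (x + y) z = cinner x z + cinner y z"
    and cinner_scaleC_left: "cinner (a *\<^sub>C x) y = a * cinner x y"
    and inner_eq_Re_cinner: "inner x y = Re (cinner x y)"

text \<open>The product type, with the library's Euclidean norm, is the Hilbert space direct sum.\<close>

instantiation prod :: (complex_hilbert_space, complex_hilbert_space) complex_hilbert_space
begin

definition scaleC_prod_def: "c *\<^sub>C z = (c *\<^sub>C fst z, c *\<^sub>C snd z)"

definition cinner_prod_def: "cinner z w = cinner (fst z) (fst w) + cinner (snd z) (snd w)"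

instance
proof
  fix a b :: complex and r :: real and x y z :: "'a \<times> 'b"
  show "a *\<^sub>C (x + y) = a *\<^sub>C x + a *\<^sub>C y"
    by (simp add: scaleC_prod_def scaleC_add_right)
  show "(a + b) *\<^sub>C x = a *\<^sub>C x + b *\<^sub>C x"
    by (simp add: scaleC_prod_def scaleC_add_left)
  show "a *\<^sub>C b *\<^sub>C x = (a * b) *\<^sub>C x"
    by (simp add: scaleC_prod_def scaleC_scaleC)
  show "r *\<^sub>R x = complex_of_real r *\<^sub>C x"
    by (simp add: scaleC_prod_def scaleR_prod_def scaleR_scaleC)
  show "cinner x y = cnj (cinner y x)"
    by (simp add: cinner_prod_def cinner_commute[symmetric])
  show "cinner (x + y) z = cinner x z + cinner y z"
    by (simp add: cinner_prod_def cinner_add_left)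
  show "cinner (a *\<^sub>C x) y = a * cinner x y"
    by (simp add: cinner_prod_def scaleC_prod_def cinner_scaleC_left distrib_left)
  show "inner x y = Re (cinner x y)"
    by (simp add: cinner_prod_def inner_prod_def inner_eq_Re_cinner)
qed

end

section \<open>Bounded operators\<close>

definition bounded_clinear ::
    "('a::complex_hilbert_space \<Rightarrow> 'b::complex_hilbert_space) \<Rightarrow> bool" where
  "bounded_clinear A \<longleftrightarrow> bounded_linear A \<and> (\<forall>c x. A (c *\<^sub>C x) = c *\<^sub>C A x)"

definition cadjoint ::
    "('a::complex_hilbert_space \<Rightarrow> 'b::complex_hilbert_space) \<Rightarrow> 'b \<Rightarrow> 'a" where
  "cadjoint A = (THE A'. \<forall>x y. cinner (A x) y = cinner x (A' y))"

definition op_matrix ::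
    "('a \<Rightarrow> 'a) \<Rightarrow> ('b \<Rightarrow> 'a) \<Rightarrow> ('a \<Rightarrow> 'b) \<Rightarrow> ('b \<Rightarrow> 'b) \<Rightarrow>
      'a::complex_hilbert_space \<times> 'b::complex_hilbert_space \<Rightarrow> 'a \<times> 'b" where
  "op_matrix A B C D z = (A (fst z) + B (snd z), C (fst z) + D (snd z))"

text \<open>
  The supremum is taken in \<open>[0, \<infinity>)\<close>: inserting 0 only matters on the zero space, which has no unit
  vectors and where the supremum of the empty set of reals would be unspecified.
\<close>

definition numerical_radius :: "('a::complex_hilbert_space \<Rightarrow> 'a) \<Rightarrow> real" where
  "numerical_radius A = Sup (insert 0 {cmod (cinner (A x) x) | x. norm x = 1})"

section \<open>Continuous functional calculus\<close>

definition op_spectrum :: "('a::complex_hilbert_space \<Rightarrow> 'a) \<Rightarrow> complex set" where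
  "op_spectrum A = {z. \<not> (\<exists>R. bounded_clinear R \<and>
     (\<forall>x. R (A x - z *\<^sub>C x) = x) \<and> (\<forall>x. A (R x) - z *\<^sub>C R x = x))}"

definition op_poly :: "real poly \<Rightarrow> ('a::complex_hilbert_space \<Rightarrow> 'a) \<Rightarrow> 'a \<Rightarrow> 'a" where
  "op_poly p A x = (\<Sum>i\<le>degree p. coeff p i *\<^sub>R (A ^^ i) x)"

text \<open>
  For a self-adjoint \<open>A\<close> (whose spectrum is real) and \<open>f\<close> real-valued and continuous on the
  spectrum, \<open>f(A)\<close> is the operator norm limit of \<open>p\<^sub>n(A)\<close> for any real polynomials \<open>p\<^sub>n\<close> converging
  to \<open>f\<close> uniformly on the spectrum of \<open>A\<close>. Only the values of \<open>f\<close> on the spectrum matter.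
\<close>

definition cfc :: "(real \<Rightarrow> real) \<Rightarrow> ('a::complex_hilbert_space \<Rightarrow> 'a) \<Rightarrow> 'a \<Rightarrow> 'a" where
  "cfc f A = (THE T. bounded_clinear T \<and>
     (\<exists>p :: nat \<Rightarrow> real poly.
        uniform_limit {t. complex_of_real t \<in> op_spectrum A} (\<lambda>n. poly (p n)) f sequentially \<and>
        (\<lambda>n. onorm (\<lambda>x. op_poly (p n) A x - T x)) \<longlonglongrightarrow> 0))"

definition op_powr :: "('a::complex_hilbert_space \<Rightarrow> 'a) \<Rightarrow> real \<Rightarrow> 'a \<Rightarrow> 'a" where
  "op_powr P s = cfc (\<lambda>t. t powr s) P"

definition op_abs :: "('a::complex_hilbert_space \<Rightarrow> 'b::complex_hilbert_space) \<Rightarrow> 'a \<Rightarrow> 'a" where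
  "op_abs A = op_powr (\<lambda>x. cadjoint A (A x)) (1/2)"

end

theory Submission
  imports Defs "HOL-Computational_Algebra.Fundamental_Theorem_Algebra"
begin

text \<open>
  The pairing of \<open>T (x, y)\<close> with \<open>(x, y)\<close> is \<open>\<langle>B y, x\<rangle> + \<langle>C x, y\<rangle>\<close>. The mixed Schwarz inequality
  \<open>|\<langle>B y, x\<rangle>| \<le> \<parallel>f(|B|) y\<parallel> \<parallel>g(|B\<^sup>*|) x\<parallel>\<close> for both terms and Cauchy-Schwarz in the plane bound its
  square by \<open>(\<parallel>f(|B|) y\<parallel>\<^sup>2 + \<parallel>g(|C\<^sup>*|) y\<parallel>\<^sup>2) (\<parallel>f(|C|) x\<parallel>\<^sup>2 + \<parallel>g(|B\<^sup>*|) x\<parallel>\<^sup>2)\<close>. Convexity of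
  \<open>t powr r\<close> and McCarthy's inequality turn the \<open>r\<close>-th powers of the two factors into the quadratic
  forms of the operators on the right, and \<open>\<parallel>x\<parallel> \<parallel>y\<parallel> \<le> 1/2\<close> on the unit sphere yields the constant
  \<open>1/2 \<le> 2 powr (r - 2)\<close>.

  The functional calculus rests on \<open>\<parallel>p(A)\<parallel> \<le> sup |p|\<close> over the spectrum of a self-adjoint \<open>A\<close>: if
  \<open>N = \<parallel>p(A)\<parallel>\<close> exceeded the supremum, then \<open>p\<^sup>2 - N\<^sup>2\<close> would have no zero on the spectrum, so each
  of its real irreducible factors, hence \<open>p(A)\<^sup>2 - N\<^sup>2\<close>, would be bounded below, although \<open>N\<^sup>2\<close> is an
  approximate eigenvalue of \<open>p(A)\<^sup>2\<close>.
\<close>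

section \<open>Complex Hilbert spaces\<close>

lemma scaleC_one [simp]: "1 *\<^sub>C x = (x::'a::complex_hilbert_space)"
  using scaleR_scaleC[of 1 x] by simp

lemma scaleC_diff_right: "c *\<^sub>C (x - y) = c *\<^sub>C x - c *\<^sub>C (y::'a::complex_hilbert_space)"
  by (metis add_diff_cancel diff_add_cancel scaleC_add_right)

lemma scaleC_scaleR: "c *\<^sub>C (a *\<^sub>R x) = a *\<^sub>R (c *\<^sub>C (x::'a::complex_hilbert_space))"
  by (simp add: scaleR_scaleC scaleC_scaleC mult.commute)

lemma cinner_scaleC_right: "cinner x (a *\<^sub>C y) = cnj a * cinner x y"
  by (metis cinner_commute cinner_scaleC_left complex_cnj_mult)

lemma inner_scaleC_left: "inner (c *\<^sub>C x) y = inner x (cnj c *\<^sub>C y)"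
  by (simp add: inner_eq_Re_cinner cinner_scaleC_left cinner_scaleC_right)

lemma Im_cinner: "Im (cinner x y) = - inner (\<i> *\<^sub>C x) y"
  by (simp add: inner_eq_Re_cinner cinner_scaleC_left)

lemma cinner_self: "cinner x x = complex_of_real ((norm x)\<^sup>2)"
proof -
  have "Im (cinner x x) = 0"
    by (metis cinner_commute Im_complex_of_real complex_cnj_cancel_iff Reals_cnj_iff complex_is_Real_iff)
  then show ?thesis
    by (simp add: complex_eq_iff power2_norm_eq_inner inner_eq_Re_cinner)
qed

lemma norm_scaleC: "norm (c *\<^sub>C x) = cmod c * norm (x::'a::complex_hilbert_space)"
proof -
  have "complex_of_real ((norm (c *\<^sub>C x))\<^sup>2) = c * cnj c * complex_of_real ((norm x)\<^sup>2)"
    by (simp add: cinner_self[symmetric] cinner_scaleC_left cinner_scaleC_right del: of_real_power)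
  also have "\<dots> = complex_of_real ((cmod c * norm x)\<^sup>2)"
    by (simp add: complex_norm_square[symmetric] power_mult_distrib)
  finally have "(norm (c *\<^sub>C x))\<^sup>2 = (cmod c * norm x)\<^sup>2"
    using of_real_eq_iff by blast
  then show ?thesis
    by (simp add: power2_eq_iff_nonneg)
qed

lemma bounded_linear_scaleC: "bounded_linear (\<lambda>x::'a::complex_hilbert_space. c *\<^sub>C x)"
  by (rule bounded_linear_intro[where K="cmod c"])
    (simp_all add: scaleC_add_right scaleC_scaleR norm_scaleC mult.commute)

text \<open>Absorbing the conjugate phase of the pairing into the first vector makes the pairing
  real and non-negative. Estimates of its modulus thereby reduce to the real inner product.\<close>

lemma cmod_cinner_rotate:
  obtains c where "cmod c = 1" "cmod (cinner x y) = inner (c *\<^sub>C x) y"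
proof (cases "cinner x y = 0")
  case True
  then show ?thesis
    using that[of 1] by (simp add: inner_eq_Re_cinner)
next
  case False
  define c where "c = cnj (sgn (cinner x y))"
  have "c * cinner x y = complex_of_real (cmod (cinner x y))"
    using False complex_norm_square[of "cinner x y"]
    by (simp add: c_def sgn_eq field_simps power2_eq_square)
  then have "inner (c *\<^sub>C x) y = cmod (cinner x y)"
    by (simp add: inner_eq_Re_cinner cinner_scaleC_left)
  moreover have "cmod c = 1"
    using False by (simp add: c_def norm_sgn)
  ultimately show ?thesis
    using that by metis
qed

lemma cmod_cinner_le: "cmod (cinner x y) \<le> norm x * norm y"
proof -
  obtain c where c: "cmod c = 1" "cmod (cinner x y) = inner (c *\<^sub>C x) y"
    by (rule cmod_cinner_rotate)
  then show ?thesis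
    using norm_cauchy_schwarz[of "c *\<^sub>C x" y] by (simp add: norm_scaleC)
qed

lemma bounded_clinear_bounded_linear: "bounded_clinear A \<Longrightarrow> bounded_linear A"
  by (simp add: bounded_clinear_def)

lemma bounded_clinear_scaleC: "bounded_clinear A \<Longrightarrow> A (c *\<^sub>C x) = c *\<^sub>C A x"
  by (simp add: bounded_clinear_def)

lemma bounded_clinear_ident: "bounded_clinear (\<lambda>x. x)"
  by (simp add: bounded_clinear_def bounded_linear_ident)

lemma bounded_clinear_add:
  "bounded_clinear A \<Longrightarrow> bounded_clinear B \<Longrightarrow> bounded_clinear (\<lambda>x. A x + B x)"
  by (simp add: bounded_clinear_def bounded_linear_add scaleC_add_right)

lemma bounded_clinear_scaleR:
  "bounded_clinear A \<Longrightarrow> bounded_clinear (\<lambda>x. a *\<^sub>R A x)"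
  by (simp add: bounded_clinear_def bounded_linear_scaleR_right bounded_linear_compose scaleC_scaleR)

lemma bounded_clinear_compose:
  "bounded_clinear A \<Longrightarrow> bounded_clinear B \<Longrightarrow> bounded_clinear (\<lambda>x. A (B x))"
  by (simp add: bounded_clinear_def bounded_linear_compose)

section \<open>The adjoint\<close>

text \<open>The representing vector minimises \<open>\<parallel>y\<parallel>\<^sup>2 / 2 - \<phi> y\<close>; by the parallelogram law the
  sublevel sets of this functional shrink to a point.\<close>

lemma riesz_representation:
  fixes \<phi> :: "'a::{real_inner, banach} \<Rightarrow> real"
  assumes "bounded_linear \<phi>"
  shows "\<exists>a. \<forall>v. \<phi> v = inner a v"
proof -
  interpret bounded_linear \<phi> by fact
  obtain K where K: "\<And>x. norm (\<phi> x) \<le> norm x * K"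
    using bounded by blast
  define J where "J y = (norm y)\<^sup>2 / 2 - \<phi> y" for y
  have J_lower: "- (K\<^sup>2) / 2 \<le> J y" for y
  proof -
    have "\<phi> y \<le> norm y * K" using K[of y] by simp
    moreover have "0 \<le> (norm y - K)\<^sup>2" by simp
    ultimately show ?thesis
      unfolding J_def power2_diff by (simp add: field_simps)
  qed
  define m where "m = Inf (range J)"
  have bdd: "bdd_below (range J)"
    using J_lower by (auto intro!: bdd_belowI[of _ "- (K\<^sup>2) / 2"])
  have m_le: "m \<le> J y" for y
    unfolding m_def using bdd by (rule cInf_lower[OF rangeI])
  define S where "S n = {y. J y \<le> m + 1 / Suc n}" for n
  have par: "(norm (x - y))\<^sup>2 / 4 = J x + J y - 2 * J ((1/2) *\<^sub>R (x + y))" for x y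
    unfolding J_def
    by (simp add: scaleR add power2_norm_eq_inner inner_add inner_diff inner_commute field_simps)
  have "continuous_on UNIV J"
    unfolding J_def
    by (intro continuous_intros linear_continuous_on bounded_linear_axioms) simp
  then have "closed (S n)" for n
    unfolding S_def by (rule closed_Collect_le[OF _ continuous_on_const])
  moreover have "S n \<noteq> {}" for n
  proof -
    have "\<exists>z\<in>range J. z < m + 1 / Suc n"
      unfolding m_def by (rule cInf_lessD) (auto simp: add_pos_pos)
    then obtain z where "J z < m + 1 / Suc n" by auto
    then have "z \<in> S n" by (simp add: S_def)
    then show ?thesis by blast
  qed
  moreover have "S n \<subseteq> S k" if "k \<le> n" for k n
  proof -
    have "1 / real (Suc n) \<le> 1 / real (Suc k)"
      using that by (simp add: frac_le)
    then show ?thesis unfolding S_def by auto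
  qed
  moreover have "\<exists>n. \<forall>x\<in>S n. \<forall>y\<in>S n. dist x y < e" if "0 < e" for e :: real
  proof -
    have "0 < e\<^sup>2 / 8" using that by simp
    then obtain n where n: "1 / real (Suc n) < e\<^sup>2 / 8"
      using nat_approx_posE by blast
    have "dist x y < e" if "x \<in> S n" "y \<in> S n" for x y
    proof -
      have "J x + J y - 2 * J ((1/2) *\<^sub>R (x + y)) \<le> 2 * (1 / Suc n)"
        using that m_le[of "(1/2) *\<^sub>R (x + y)"] by (simp add: S_def)
      then have "(norm (x - y))\<^sup>2 < e\<^sup>2"
        using par[of x y] n by simp
      then show ?thesis
        using \<open>0 < e\<close> by (simp add: dist_norm power_less_imp_less_base)
    qed
    then show ?thesis by blast
  qed
  ultimately obtain a where a: "\<And>n. a \<in> S n"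
    using decreasing_closed_nest[of S] by metis
  have "J a \<le> m"
  proof (rule field_le_epsilon)
    fix e :: real assume "0 < e"
    then obtain n where "1 / real (Suc n) < e"
      using nat_approx_posE by blast
    then show "J a \<le> m + e"
      using a[of n] by (simp add: S_def)
  qed
  then have J_min: "J a \<le> J y" for y
    using m_le[of y] by simp
  have "\<phi> v = inner a v" for v
  proof (cases "v = 0")
    case False
    \<comment> \<open>\<open>d\<close> is the directional derivative of \<open>J\<close> at
      \<open>a\<close> along \<open>v\<close>, and \<open>s\<close> minimises the resulting
      quadratic \<open>s * d + s^2 * norm v^2 / 2\<close>. Its minimum is negative unless
      \<open>d = 0\<close>, which would contradict \<open>J_min\<close>.\<close>
    define d where "d = inner a v - \<phi> v"
    define s where "s = - d / (norm v)\<^sup>2"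
    have "J (a + s *\<^sub>R v) = J a + s * d + s\<^sup>2 * (norm v)\<^sup>2 / 2"
      unfolding J_def d_def power2_norm_eq_inner
      by (simp add: scaleR add inner_add_left inner_add_right inner_commute[of v a] power2_eq_square
          algebra_simps add_divide_distrib)
    then have "0 \<le> s * d + s\<^sup>2 * (norm v)\<^sup>2 / 2"
      using J_min[of "a + s *\<^sub>R v"] by simp
    also have "\<dots> = - (d\<^sup>2 / (2 * (norm v)\<^sup>2))"
      using False by (simp add: s_def power2_eq_square field_simps)
    finally have "d = 0"
      using False by (simp add: field_simps divide_le_0_iff zero_le_divide_iff)
    then show ?thesis by (simp add: d_def)
  qed (simp add: zero)
  then show ?thesis by blast
qed

text \<open>The imaginary part of the pairing is, up to sign, the real pairing with the first vector
  multiplied by the imaginary unit. Complex linearity moves that unit through \<open>A\<close>, so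
  the real adjoint relation controls both parts.\<close>

lemma cinner_adjoint:
  assumes "bounded_clinear A" "\<And>x y. inner (A x) y = inner x (A' y)"
  shows "cinner (A x) y = cinner x (A' y)"
proof -
  have "inner (\<i> *\<^sub>C A x) y = inner (\<i> *\<^sub>C x) (A' y)"
    using assms(2)[of "\<i> *\<^sub>C x" y] by (simp add: bounded_clinear_scaleC[OF assms(1)])
  then show ?thesis
    using assms(2)[of x y] by (simp add: complex_eq_iff Im_cinner) (simp add: inner_eq_Re_cinner)
qed

lemma cadjoint_eqI:
  assumes "bounded_clinear A" "\<And>x y. inner (A x) y = inner x (A' y)"
  shows "cadjoint A = A'"
  unfolding cadjoint_def
proof (rule the_equality)
  show "\<forall>x y. cinner (A x) y = cinner x (A' y)"
    using cinner_adjoint[OF assms] by blast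
  fix D assume D: "\<forall>x y. cinner (A x) y = cinner x (D y)"
  have "inner x (D y) = inner x (A' y)" for x y
    using D assms(2)[of x y] by (simp add: inner_eq_Re_cinner)
  then show "D = A'"
    by (metis ext vector_eq_rdot inner_commute)
qed

text \<open>Riesz representation of the functionals \<open>inner (A x) y\<close> in \<open>x\<close>
  defines \<open>A'\<close> pointwise, and uniqueness of the representing vector gives linearity.
  Boundedness comes from pairing \<open>A' y\<close> with itself and moving one copy back through
  \<open>A\<close>.\<close>

lemma adjoint_exists:
  assumes A: "bounded_clinear A"
  shows "\<exists>A'. bounded_clinear A' \<and> (\<forall>x y. inner (A x) y = inner x (A' y))"
proof -
  interpret bounded_linear A using A by (rule bounded_clinear_bounded_linear)
  have "\<exists>a. \<forall>x. inner (A x) y = inner a x" for y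
    by (rule riesz_representation)
      (rule bounded_linear_compose[OF bounded_linear_inner_left bounded_linear_axioms])
  then obtain A' where "\<And>x y. inner (A x) y = inner (A' y) x"
    by metis
  then have A': "inner (A x) y = inner x (A' y)" for x y
    by (simp add: inner_commute)
  have eqI: "u = v" if "\<And>x. inner x u = inner x v" for u v :: 'a
    using that vector_eq_ldot by blast
  obtain K where K: "0 < K" "\<And>x. norm (A x) \<le> norm x * K"
    using pos_bounded by blast
  have "norm (A' y) \<le> norm y * K" for y
  proof (cases "A' y = 0")
    case False
    have "norm (A' y) * norm (A' y) = inner (A (A' y)) y"
      by (simp add: A' power2_norm_eq_inner[symmetric] power2_eq_square)
    also have "\<dots> \<le> norm (A (A' y)) * norm y"
      by (rule norm_cauchy_schwarz)
    also have "\<dots> \<le> norm (A' y) * K * norm y"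
      by (intro mult_right_mono K) simp
    finally show ?thesis using False by (simp add: mult.commute)
  qed (use K in simp)
  moreover have "A' (x + y) = A' x + A' y" for x y
    by (rule eqI) (simp add: A'[symmetric] inner_add_right)
  moreover have "A' (c *\<^sub>R x) = c *\<^sub>R A' x" for x c
    by (rule eqI) (simp add: A'[symmetric])
  ultimately have "bounded_linear A'"
    by (intro bounded_linear_intro)
  moreover have "A' (c *\<^sub>C y) = c *\<^sub>C A' y" for c y
  proof (rule eqI)
    fix x
    have "inner (cnj c *\<^sub>C A x) y = inner (cnj c *\<^sub>C x) (A' y)"
      by (metis A' bounded_clinear_scaleC[OF A])
    then have "inner (A x) (c *\<^sub>C y) = inner x (c *\<^sub>C A' y)"
      by (simp only: inner_scaleC_left complex_cnj_cnj)
    then show "inner x (A' (c *\<^sub>C y)) = inner x (c *\<^sub>C A' y)"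
      by (simp only: A')
  qed
  ultimately show ?thesis
    using A' unfolding bounded_clinear_def by blast
qed

lemma
  assumes "bounded_clinear A"
  shows bounded_clinear_cadjoint: "bounded_clinear (cadjoint A)"
    and inner_cadjoint: "inner (A x) y = inner x (cadjoint A y)"
    and cadjoint_cadjoint: "cadjoint (cadjoint A) = A"
proof -
  obtain A' where A': "bounded_clinear A'" "\<And>x y. inner (A x) y = inner x (A' y)"
    using adjoint_exists[OF assms] by blast
  have eq: "cadjoint A = A'"
    by (rule cadjoint_eqI) (use assms A' in auto)
  show "bounded_clinear (cadjoint A)" "inner (A x) y = inner x (cadjoint A y)"
    by (simp_all add: eq A')
  show "cadjoint (cadjoint A) = A"
    unfolding eq by (rule cadjoint_eqI) (use A' in \<open>auto simp: inner_commute\<close>)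
qed

section \<open>Real points of the spectrum\<close>

abbreviation real_spectrum :: "('a::complex_hilbert_space \<Rightarrow> 'a) \<Rightarrow> real set" where
  "real_spectrum A \<equiv> {t. complex_of_real t \<in> op_spectrum A}"

text \<open>The Lax-Milgram argument: for a suitable step \<open>k\<close>, the map sending
  \<open>x\<close> to \<open>x - k (S x - y)\<close> is a contraction, and its fixed point solves
  the equation.\<close>

lemma coercive_surj:
  fixes S :: "'a::{real_inner, banach} \<Rightarrow> 'a"
  assumes "bounded_linear S" "0 < c" and coercive: "\<And>x. c * (norm x)\<^sup>2 \<le> inner (S x) x"
  shows "\<exists>x. S x = y"
proof -
  interpret bounded_linear S by fact
  obtain K0 where K0: "0 < K0" "\<And>x. norm (S x) \<le> norm x * K0"
    using pos_bounded by blast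
  \<comment> \<open>A nonzero space forces \<open>c <= K0\<close>, but on the zero space
    \<open>K0\<close> may be smaller. The maximum ensures \<open>0 <= q\<close>.\<close>
  define K where "K = max K0 c"
  have K: "0 < K" "c \<le> K" "norm (S x) \<le> K * norm x" for x
    using K0(1) \<open>0 < c\<close> order_trans[OF K0(2)[of x] mult_left_mono[of K0 K "norm x"]]
    by (auto simp: K_def mult.commute)
  \<comment> \<open>This \<open>k\<close> minimises \<open>1 - 2 k c + k^2 K^2\<close>, the bound on
    the squared contraction factor; the minimum is \<open>q\<close>.\<close>
  define k where "k = c / K\<^sup>2"
  define q where "q = 1 - c\<^sup>2 / K\<^sup>2"
  have "c\<^sup>2 \<le> K\<^sup>2"
    using K \<open>0 < c\<close> by (intro power_mono) auto
  then have q: "0 \<le> q" "q < 1"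
    using K \<open>0 < c\<close> by (auto simp: q_def)
  have contract: "norm (x - k *\<^sub>R S x) \<le> sqrt q * norm x" for x
  proof -
    have "0 < k" using K(1) \<open>0 < c\<close> by (simp add: k_def)
    have "(norm (x - k *\<^sub>R S x))\<^sup>2 = (norm x)\<^sup>2 - 2 * k * inner (S x) x + k\<^sup>2 * (norm (S x))\<^sup>2"
      unfolding power2_norm_eq_inner
      by (simp add: inner_diff_left inner_diff_right inner_commute[of x "S x"] power2_eq_square
          algebra_simps)
    also have "\<dots> \<le> (norm x)\<^sup>2 - 2 * k * (c * (norm x)\<^sup>2) + k\<^sup>2 * (K * norm x)\<^sup>2"
      using mult_left_mono[OF coercive[of x], of "2 * k"] \<open>0 < k\<close>
        mult_left_mono[OF power_mono[OF K(3)[of x] norm_ge_zero, of 2], of "k\<^sup>2"]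
      by (smt (verit) zero_le_power2)
    also have "\<dots> = (1 - 2 * (k * c) + k\<^sup>2 * K\<^sup>2) * (norm x)\<^sup>2"
      by (simp add: power_mult_distrib algebra_simps)
    also have "\<dots> = q * (norm x)\<^sup>2"
    proof -
      have "k * c = c\<^sup>2 / K\<^sup>2" "k\<^sup>2 * K\<^sup>2 = c\<^sup>2 / K\<^sup>2"
        using K(1) by (simp_all add: k_def power2_eq_square)
      then show ?thesis by (simp add: q_def)
    qed
    also have "\<dots> = (sqrt q * norm x)\<^sup>2"
      using q by (simp add: power_mult_distrib)
    finally show ?thesis
      by (rule power2_le_imp_le) (simp add: q)
  qed
  define F where "F x = x - k *\<^sub>R (S x - y)" for x
  have "dist (F x) (F z) \<le> sqrt q * dist x z" for x z
    using contract[of "x - z"] by (simp add: F_def dist_norm diff algebra_simps)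
  then obtain x where "F x = x"
    using banach_fix_type[of "sqrt q" F] q by auto
  moreover have "k \<noteq> 0" using K(1) \<open>0 < c\<close> by (simp add: k_def)
  ultimately have "S x = y"
    by (simp add: F_def)
  then show ?thesis by blast
qed

text \<open>The lower bound gives injectivity of \<open>A - t\<close> and the bound
  \<open>1 / c\<close> for its inverse. Injectivity also yields complex linearity of the inverse
  chosen through surjectivity.\<close>

lemma not_in_real_spectrumI:
  assumes A: "bounded_clinear A" and "0 < c"
    and below: "\<And>x. c * norm x \<le> norm (A x - t *\<^sub>R x)"
    and surj: "\<And>y. \<exists>x. A x - t *\<^sub>R x = y"
  shows "t \<notin> real_spectrum A"
proof -
  interpret bounded_linear A using A by (rule bounded_clinear_bounded_linear)
  define M where "M x = A x - t *\<^sub>R x" for x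
  have M_diff: "M (u - v) = M u - M v" and M_add: "M (u + v) = M u + M v"
    and M_scaleR: "M (a *\<^sub>R u) = a *\<^sub>R M u" and M_scaleC: "M (z *\<^sub>C u) = z *\<^sub>C M u" for u v a z
    unfolding M_def
    by (simp_all add: diff add scaleR scaleR_diff_right scaleR_add_right scaleR_left_commute
        bounded_clinear_scaleC[OF A] scaleC_diff_right scaleC_scaleR)
  obtain R where R: "\<And>y. M (R y) = y"
    using surj unfolding M_def by metis
  have inj: "u = v" if "M u = M v" for u v
  proof -
    have "c * norm (u - v) \<le> 0"
      using below[of "u - v", folded M_def] that by (simp add: M_diff)
    then show ?thesis using \<open>0 < c\<close> by (simp add: mult_le_0_iff)
  qed
  have "R (x + y) = R x + R y" for x y
    by (rule inj) (simp add: R M_add)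
  moreover have "R (a *\<^sub>R x) = a *\<^sub>R R x" for x a
    by (rule inj) (simp add: R M_scaleR)
  moreover have "norm (R x) \<le> norm x * (1 / c)" for x
    using below[of "R x", folded M_def] \<open>0 < c\<close> by (simp add: R field_simps)
  moreover have "R (a *\<^sub>C x) = a *\<^sub>C R x" for x a
    by (rule inj) (simp add: R M_scaleC)
  ultimately have "bounded_clinear R"
    unfolding bounded_clinear_def by (blast intro: bounded_linear_intro)
  moreover have "R (M x) = x" for x
    by (rule inj) (rule R)
  ultimately show ?thesis
    using R by (auto simp: op_spectrum_def scaleR_scaleC M_def)
qed

text \<open>Cauchy-Schwarz turns coercivity into the lower bound, and \<open>coercive_surj\<close>
  gives surjectivity. The factor \<open>s\<close> covers with one statement the points to the left
  (\<open>s = 1\<close>) and to the right (\<open>s = -1\<close>) of the numerical range.\<close>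

lemma coercive_not_in_real_spectrum:
  assumes A: "bounded_clinear A" and "0 < c" "s \<noteq> 0"
    and coercive: "\<And>x. c * (norm x)\<^sup>2 \<le> s * inner (A x - t *\<^sub>R x) x"
  shows "t \<notin> real_spectrum A"
proof (rule not_in_real_spectrumI[OF A])
  interpret bounded_linear A using A by (rule bounded_clinear_bounded_linear)
  show "0 < c / \<bar>s\<bar>" using assms by simp
  show "c / \<bar>s\<bar> * norm x \<le> norm (A x - t *\<^sub>R x)" for x
  proof (cases "x = 0")
    case False
    have "c * (norm x)\<^sup>2 \<le> \<bar>s\<bar> * \<bar>inner (A x - t *\<^sub>R x) x\<bar>"
      using coercive[of x] by (metis abs_ge_self abs_mult order_trans)
    also have "\<dots> \<le> \<bar>s\<bar> * (norm (A x - t *\<^sub>R x) * norm x)"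
      by (intro mult_left_mono Cauchy_Schwarz_ineq2) simp
    finally show ?thesis
      using False \<open>s \<noteq> 0\<close> by (simp add: field_simps power2_eq_square)
  qed simp
  have "bounded_linear (\<lambda>x. s *\<^sub>R (A x - t *\<^sub>R x))"
    by (intro bounded_linear_const_scaleR bounded_linear_sub bounded_linear_axioms
        bounded_linear_scaleR_right)
  then have "\<exists>x. s *\<^sub>R (A x - t *\<^sub>R x) = s *\<^sub>R y" for y
    by (rule coercive_surj[OF _ \<open>0 < c\<close>]) (use coercive in simp)
  then show "\<exists>x. A x - t *\<^sub>R x = y" for y
    using \<open>s \<noteq> 0\<close> by simp
qed

lemma not_in_real_spectrumE:
  assumes "t \<notin> real_spectrum A"
  obtains c where "0 < c" "\<And>x. c * norm x \<le> norm (A x - t *\<^sub>R x)"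
proof -
  obtain R where "bounded_clinear R" and R: "\<And>x. R (A x - t *\<^sub>R x) = x"
    using assms by (auto simp: op_spectrum_def scaleR_scaleC)
  then obtain K where K: "0 < K" "\<And>x. norm (R x) \<le> norm x * K"
    using bounded_linear.pos_bounded bounded_clinear_bounded_linear by blast
  show ?thesis
  proof (rule that)
    show "0 < 1 / K" using K(1) by simp
    show "1 / K * norm x \<le> norm (A x - t *\<^sub>R x)" for x
      using K(2)[of "A x - t *\<^sub>R x"] K(1) by (simp add: R field_simps)
  qed
qed

section \<open>Polynomials of an operator\<close>

lemma op_poly_altdef:
  assumes "degree p \<le> n"
  shows "op_poly p A x = (\<Sum>i\<le>n. coeff p i *\<^sub>R (A ^^ i) x)"
  unfolding op_poly_def
  by (rule sum.mono_neutral_left) (use assms in \<open>auto simp: coeff_eq_0\<close>)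

lemma op_poly_0 [simp]: "op_poly 0 A x = 0"
  by (simp add: op_poly_def)

lemma op_poly_add: "op_poly (p + q) A x = op_poly p A x + op_poly q A x"
proof -
  define n where "n = max (degree p) (degree q)"
  have "degree (p + q) \<le> n" "degree p \<le> n" "degree q \<le> n"
    by (auto simp: n_def intro: degree_add_le_max)
  then show ?thesis
    by (simp add: op_poly_altdef[of _ n] sum.distrib scaleR_add_left)
qed

lemma op_poly_smult: "op_poly (smult a p) A x = a *\<^sub>R op_poly p A x"
  by (simp add: op_poly_altdef[OF degree_smult_le] op_poly_altdef[OF order_refl] scaleR_sum_right)

lemma op_poly_diff: "op_poly (p - q) A x = op_poly p A x - op_poly q A x"
  using op_poly_add[of p "smult (-1) q" A x] op_poly_smult[of "-1" q A x] by simp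

lemma op_poly_pCons:
  assumes "bounded_linear A"
  shows "op_poly (pCons a p) A x = a *\<^sub>R x + A (op_poly p A x)"
proof -
  interpret bounded_linear A by fact
  have "op_poly (pCons a p) A x = (\<Sum>i\<le>Suc (degree p). coeff (pCons a p) i *\<^sub>R (A ^^ i) x)"
    by (rule op_poly_altdef) (rule degree_pCons_le)
  then show ?thesis
    by (simp add: sum.atMost_Suc_shift op_poly_def sum scaleR del: sum.atMost_Suc)
qed

lemma op_poly_mult:
  assumes "bounded_linear A"
  shows "op_poly (p * q) A x = op_poly p A (op_poly q A x)"
  by (induction p) (simp_all add: op_poly_pCons[OF assms] op_poly_add op_poly_smult)

lemma bounded_clinear_op_poly:
  assumes "bounded_clinear A"
  shows "bounded_clinear (op_poly p A)"
proof -
  have "bounded_clinear (\<lambda>x. op_poly p A x)"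
  proof (induction p)
    case 0
    then show ?case
      using bounded_clinear_scaleR[OF bounded_clinear_ident, of 0] by simp
  next
    case (pCons a p)
    then show ?case
      by (simp add: op_poly_pCons[OF bounded_clinear_bounded_linear[OF assms]] bounded_clinear_add
          bounded_clinear_scaleR bounded_clinear_ident bounded_clinear_compose[OF assms])
  qed
  then show ?thesis by simp
qed

text \<open>With \<open>B = D = A\<close> this says that \<open>A\<close> commutes with its
  polynomials. With two different operators it later carries functions of \<open>|B|\<close> across
  \<open>B\<close>.\<close>

lemma op_poly_intertwine:
  assumes "bounded_linear A" "bounded_linear D" "bounded_linear B"
    and "\<And>x. B (A x) = D (B x)"
  shows "B (op_poly p A x) = op_poly p D (B x)"
proof -
  interpret B: bounded_linear B by fact
  show ?thesis
    by (induction p) (simp_all add: op_poly_pCons assms B.add B.scaleR B.zero)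
qed

text \<open>Symmetry for the real inner product is enough: with complex linearity,
  \<open>cinner_adjoint\<close> upgrades it to the complex one.\<close>

definition selfadjoint :: "('a::complex_hilbert_space \<Rightarrow> 'a) \<Rightarrow> bool" where
  "selfadjoint A \<longleftrightarrow> bounded_clinear A \<and> (\<forall>x y. inner (A x) y = inner x (A y))"

lemma selfadjointD:
  assumes "selfadjoint A"
  shows "bounded_clinear A" "bounded_linear A" "inner (A x) y = inner x (A y)"
  using assms by (auto simp: selfadjoint_def bounded_clinear_def)

lemma selfadjoint_op_poly:
  assumes A: "selfadjoint A"
  shows "selfadjoint (op_poly p A)"
proof -
  note A' = selfadjointD[OF A]
  have "inner (op_poly p A x) y = inner x (op_poly p A y)" for x y
  proof (induction p arbitrary: x y)
    case (pCons a p)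
    have "A (op_poly p A y) = op_poly p A (A y)"
      by (rule op_poly_intertwine) (use A' in auto)
    then show ?case
      by (simp add: op_poly_pCons A' inner_add_left inner_add_right pCons.IH)
  qed simp
  then show ?thesis
    by (simp add: selfadjoint_def bounded_clinear_op_poly A')
qed

section \<open>Norm of a polynomial of a self-adjoint operator, bounded by its values on the
  spectrum\<close>

lemma real_poly_factor:
  fixes q :: "real poly"
  assumes "0 < degree q"
  shows "(\<exists>t. [:- t, 1:] dvd q) \<or> (\<exists>a b. b \<noteq> 0 \<and> [:a\<^sup>2 + b\<^sup>2, - 2 * a, 1:] dvd q)"
proof -
  \<comment> \<open>\<open>ev\<close> evaluates a real polynomial at a complex point. Its
    homomorphism laws transport a complex root of \<open>q\<close> to the factors of
    \<open>q\<close>.\<close>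
  define ev where "ev p z = poly (map_poly complex_of_real p) z" for p z
  have ev_pCons: "ev (pCons a p) z = of_real a + z * ev p z" for a p z
    unfolding ev_def by (simp add: map_poly_pCons)
  have ev_0: "ev 0 z = 0" for z
    by (simp add: ev_def)
  have ev_add: "ev (p + p') z = ev p z + ev p' z" for p p' z
    by (induction p p' rule: poly_induct2) (simp_all add: ev_0 ev_pCons distrib_left)
  have ev_smult: "ev (smult a p) z = of_real a * ev p z" for a p z
    by (induction p) (simp_all add: ev_0 ev_pCons algebra_simps)
  have ev_mult: "ev (p * p') z = ev p z * ev p' z" for p p' z
    by (induction p) (simp_all add: ev_0 ev_add ev_pCons ev_smult algebra_simps)
  have "degree (map_poly complex_of_real q) = degree q"
    by (rule degree_map_poly) simp
  then obtain z where z: "ev q z = 0"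
    using alg_closed_imp_poly_has_root[of "map_poly complex_of_real q"] assms by (auto simp: ev_def)
  show ?thesis
  proof (cases "Im z = 0")
    case True
    have "ev p (of_real t) = of_real (poly p t)" for p t
      by (induction p) (simp_all add: ev_0 ev_pCons)
    then have "poly q (Re z) = 0"
      using z True by (metis of_real_Re complex_is_Real_iff of_real_eq_0_iff)
    then show ?thesis by (auto simp: poly_eq_0_iff_dvd)
  next
    case False
    define d where "d = [:(Re z)\<^sup>2 + (Im z)\<^sup>2, - 2 * Re z, 1:]"
    have "ev d z = 0"
      by (simp add: d_def ev_pCons ev_0 complex_eq_iff power2_eq_square algebra_simps)
    \<comment> \<open>The roots of \<open>d\<close> are \<open>z\<close> and its conjugate. The
      remainder \<open>u + v X\<close> vanishes at the non-real \<open>z\<close>, so its imaginary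
      part gives \<open>v = 0\<close>, and then \<open>u = 0\<close>.\<close>
    moreover have "q = q div d * d + q mod d" by simp
    ultimately have mod: "ev (q mod d) z = 0"
      using z ev_add[of "q div d * d" "q mod d" z] by (simp add: ev_mult)
    have "degree (q mod d) < 2"
      using degree_mod_less[of d q] by (auto simp: d_def)
    then have "coeff (q mod d) n = coeff [:coeff (q mod d) 0, coeff (q mod d) 1:] n" for n
      by (cases n; cases "n - 1") (auto simp: coeff_eq_0)
    then obtain u v where uv: "q mod d = [:u, v:]"
      using poly_eq_iff by blast
    then have "of_real u + z * of_real v = 0"
      using mod by (simp add: ev_pCons ev_0)
    then have "v = 0 \<and> u = 0"
      using False by (auto simp: complex_eq_iff)
    then have "d dvd q" using uv by (simp add: mod_eq_0_iff_dvd)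
    then show ?thesis using False d_def by blast
  qed
qed

text \<open>Induction on the degree, splitting off a real factor. A linear factor
  \<open>X - t\<close> is bounded below because \<open>t\<close> is outside the spectrum; a factor
  \<open>(X - a)^2 + b^2\<close> is bounded below by \<open>b^2\<close> because
  \<open>(A - a)^2\<close> is positive. Lower bounds multiply under composition.\<close>

lemma op_poly_bounded_below:
  assumes A: "selfadjoint A" and "q \<noteq> 0"
    and "\<And>t. t \<in> real_spectrum A \<Longrightarrow> poly q t \<noteq> 0"
  shows "\<exists>c>0. \<forall>x. c * norm x \<le> norm (op_poly q A x)"
  using assms(2,3)
proof (induction "degree q" arbitrary: q rule: less_induct)
  case less
  note A' = selfadjointD[OF A]
  interpret bounded_linear A by (rule A')
  note pc = op_poly_pCons[OF A'(2)]
  show ?case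
  proof (cases "degree q = 0")
    case True
    then obtain a where "q = [:a:]" using degree_eq_zeroE by blast
    then show ?thesis
      using less.prems(1) by (intro exI[of _ "\<bar>a\<bar>"]) (auto simp: pc zero)
  next
    case False
    have "\<exists>d c. d dvd q \<and> 0 < degree d \<and> 0 < c \<and> (\<forall>x. c * norm x \<le> norm (op_poly d A x))"
    proof -
      consider t where "[:- t, 1:] dvd q"
        | a b :: real where "b \<noteq> 0" "[:a\<^sup>2 + b\<^sup>2, - 2 * a, 1:] dvd q"
        using real_poly_factor[of q] False by auto
      then show ?thesis
      proof cases
        case (1 t)
        then have "t \<notin> real_spectrum A"
          using less.prems(2) by (auto simp: poly_eq_0_iff_dvd)
        then obtain c where "0 < c" "\<And>x. c * norm x \<le> norm (A x - t *\<^sub>R x)"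
          by (rule not_in_real_spectrumE) blast
        then show ?thesis
          using 1 by (intro exI[of _ "[:- t, 1:]"] exI[of _ c]) (auto simp: pc zero)
      next
        case (2 a b)
        have "b\<^sup>2 * norm x \<le> norm (op_poly [:a\<^sup>2 + b\<^sup>2, - 2 * a, 1:] A x)" (is "_ \<le> norm ?y") for x
        proof (cases "x = 0")
          case False
          have y: "?y = (a\<^sup>2 + b\<^sup>2) *\<^sub>R x - (2 * a) *\<^sub>R A x + A (A x)"
            by (simp add: pc zero add diff scaleR algebra_simps)
          have "inner ?y x = (norm (A x - a *\<^sub>R x))\<^sup>2 + b\<^sup>2 * (norm x)\<^sup>2"
            unfolding y power2_norm_eq_inner
            by (simp add: A'(3) inner_add_left inner_diff_left inner_diff_right power2_eq_square
                algebra_simps)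
          then have "b\<^sup>2 * (norm x)\<^sup>2 \<le> inner ?y x"
            using zero_le_power2[of "norm (A x - a *\<^sub>R x)"] by linarith
          also have "\<dots> \<le> norm ?y * norm x" by (rule norm_cauchy_schwarz)
          finally show ?thesis using False by (simp add: power2_eq_square)
        qed simp
        then show ?thesis
          using 2 by (intro exI[of _ "[:a\<^sup>2 + b\<^sup>2, - 2 * a, 1:]"] exI[of _ "b\<^sup>2"]) auto
      qed
    qed
    then obtain d c1 q' where d: "q = d * q'" "0 < degree d"
      and c1: "0 < c1" "\<And>x. c1 * norm x \<le> norm (op_poly d A x)"
      by (auto elim: dvdE)
    have "q' \<noteq> 0" "d \<noteq> 0" using d less.prems by auto
    then have "degree q' < degree q" using d by (simp add: degree_mult_eq)
    then obtain c2 where c2: "0 < c2" "\<And>x. c2 * norm x \<le> norm (op_poly q' A x)"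
      using less.hyps[of q'] less.prems \<open>q' \<noteq> 0\<close> d(1) by auto
    have "c1 * c2 * norm x \<le> norm (op_poly q A x)" for x
    proof -
      have "c1 * (c2 * norm x) \<le> c1 * norm (op_poly q' A x)"
        using c1(1) c2(2)[of x] by simp
      also have "\<dots> \<le> norm (op_poly d A (op_poly q' A x))" by (rule c1)
      finally show ?thesis by (simp add: d(1) op_poly_mult[OF A'(2)])
    qed
    then show ?thesis using c1(1) c2(1) by (intro exI[of _ "c1 * c2"]) auto
  qed
qed

text \<open>The square of the norm of a self-adjoint operator is an approximate eigenvalue of its square.\<close>

lemma selfadjoint_trivial_of_bounded_below:
  fixes S :: "'a::complex_hilbert_space \<Rightarrow> 'a" and x :: 'a
  assumes S: "selfadjoint S" and "0 < c"
    and below: "\<And>x. c * norm x \<le> norm (S (S x) - (onorm S)\<^sup>2 *\<^sub>R x)"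
  shows "x = 0"
proof (rule ccontr)
  assume "x \<noteq> 0"
  note S' = selfadjointD[OF S]
  define N where "N = onorm S"
  have N: "0 \<le> N" "norm (S x) \<le> N * norm x" for x
    unfolding N_def using onorm_pos_le[OF S'(2)] onorm[OF S'(2)] by auto
  \<comment> \<open>Expand the square of \<open>norm (S (S x) - N^2 x)\<close>, use that the pairing
    of \<open>S (S x)\<close> with \<open>x\<close> is \<open>norm (S x)^2\<close>, and bound
    \<open>norm (S (S x))\<close> by \<open>N * norm (S x)\<close>.\<close>
  have key: "c\<^sup>2 * (norm x)\<^sup>2 \<le> N\<^sup>2 * (N\<^sup>2 * (norm x)\<^sup>2 - (norm (S x))\<^sup>2)" for x
  proof -
    have "c\<^sup>2 * (norm x)\<^sup>2 \<le> (norm (S (S x) - N\<^sup>2 *\<^sub>R x))\<^sup>2"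
      using power_mono[OF below[of x], of 2] \<open>0 < c\<close> by (simp add: N_def power_mult_distrib)
    also have "\<dots> = (norm (S (S x)))\<^sup>2 - 2 * N\<^sup>2 * (norm (S x))\<^sup>2 + N\<^sup>2 * (N\<^sup>2 * (norm x)\<^sup>2)"
      using S'(3)[of "S x" x] unfolding power2_norm_eq_inner
      by (simp add: inner_diff_left inner_diff_right inner_commute[of x "S (S x)"] power2_eq_square
          algebra_simps)
    finally show ?thesis
      using power_mono[OF N(2)[of "S x"], of 2] by (simp add: power_mult_distrib algebra_simps)
  qed
  have "N \<noteq> 0"
    using key[of x] \<open>x \<noteq> 0\<close> \<open>0 < c\<close> by (auto simp: mult_le_0_iff)
  then have "0 < N" using N(1) by simp
  \<comment> \<open>Solving \<open>key\<close> for \<open>norm (S x)\<close> gives a bound for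
    \<open>S\<close> strictly below its operator norm \<open>N\<close>, which is the
    contradiction.\<close>
  have "norm (S x) \<le> sqrt (N\<^sup>2 - c\<^sup>2 / N\<^sup>2) * norm x" for x
  proof -
    have "(norm (S x))\<^sup>2 \<le> (N\<^sup>2 - c\<^sup>2 / N\<^sup>2) * (norm x)\<^sup>2"
      using key[of x] \<open>0 < N\<close> by (simp add: field_simps)
    then have "sqrt ((norm (S x))\<^sup>2) \<le> sqrt ((N\<^sup>2 - c\<^sup>2 / N\<^sup>2) * (norm x)\<^sup>2)"
      by (rule real_sqrt_le_mono)
    then show ?thesis by (simp add: real_sqrt_mult)
  qed
  note bound = this
  \<comment> \<open>\<open>sqrt\<close> of a negative real is negative, so the sign has to be read
    off from the bound at a nonzero vector.\<close>
  have "0 \<le> sqrt (N\<^sup>2 - c\<^sup>2 / N\<^sup>2)"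
    using order_trans[OF norm_ge_zero bound[of x]] \<open>x \<noteq> 0\<close> by (simp add: zero_le_mult_iff)
  then have "N \<le> sqrt (N\<^sup>2 - c\<^sup>2 / N\<^sup>2)"
    using onorm_bound[OF _ bound] by (simp add: N_def)
  also have "\<dots> < sqrt (N\<^sup>2)"
    using \<open>0 < N\<close> \<open>0 < c\<close> by (intro real_sqrt_less_mono) simp
  finally show False using \<open>0 < N\<close> by simp
qed

text \<open>If the operator norm exceeded \<open>M\<close>, the approximate eigenvalue argument
  would force every vector to be 0, where the inequality is trivial.\<close>

lemma op_poly_norm_le:
  assumes A: "selfadjoint A" and "0 \<le> M"
    and bound: "\<And>t. t \<in> real_spectrum A \<Longrightarrow> \<bar>poly p t\<bar> \<le> M"
  shows "norm (op_poly p A x) \<le> M * norm x"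
proof (cases "onorm (op_poly p A) \<le> M")
  case True
  note pA = selfadjointD(2)[OF selfadjoint_op_poly[OF A]]
  show ?thesis
    using onorm[OF pA, of p x] mult_right_mono[OF True norm_ge_zero] by (rule order_trans)
next
  case False
  define N where "N = onorm (op_poly p A)"
  note A' = selfadjointD[OF A]
  interpret bounded_linear A by (rule A')
  note pc = op_poly_pCons[OF A'(2)]
  define q where "q = p * p - [:N\<^sup>2:]"
  have nonzero: "poly q t \<noteq> 0" if "t \<in> real_spectrum A" for t
  proof
    assume "poly q t = 0"
    then have "(poly p t)\<^sup>2 = N\<^sup>2" by (simp add: q_def power2_eq_square)
    moreover have "(poly p t)\<^sup>2 \<le> M\<^sup>2"
      using bound[OF that] \<open>0 \<le> M\<close> abs_le_square_iff[of "poly p t" M] by simp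
    ultimately have "N\<^sup>2 \<le> M\<^sup>2" by simp
    then have "N \<le> M" using \<open>0 \<le> M\<close> by (rule power2_le_imp_le)
    then show False using False by (simp add: N_def)
  qed
  have "x = 0"
  proof (cases "q = 0")
    case False
    obtain c where "0 < c" "\<And>x. c * norm x \<le> norm (op_poly q A x)"
      using op_poly_bounded_below[OF A False nonzero] by auto
    then show ?thesis
      by (intro selfadjoint_trivial_of_bounded_below[OF selfadjoint_op_poly[OF A, of p]])
        (auto simp: q_def N_def op_poly_diff op_poly_mult[OF A'(2)] pc zero)
  next
    case True
    \<comment> \<open>If \<open>q = 0\<close>, then \<open>nonzero\<close> says that the real
      spectrum is empty. Hence \<open>X^2 - (onorm A)^2\<close> vacuously has no zero on it, and the
      argument applies to \<open>A\<close> itself in place of \<open>p(A)\<close>.\<close>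
    define q' where "q' = [:- ((onorm A)\<^sup>2), 0, 1:]"
    have "q' \<noteq> 0" by (simp add: q'_def)
    moreover have "poly q' t \<noteq> 0" if "t \<in> real_spectrum A" for t
      using nonzero[OF that] True by simp
    ultimately obtain c where "0 < c" "\<And>x. c * norm x \<le> norm (op_poly q' A x)"
      using op_poly_bounded_below[OF A] by blast
    then show ?thesis
      by (intro selfadjoint_trivial_of_bounded_below[OF A])
        (auto simp: q'_def pc zero)
  qed
  then show ?thesis
    by (simp add: linear_0[OF bounded_linear.linear[OF selfadjointD(2)[OF selfadjoint_op_poly[OF A]]]])
qed

section \<open>Continuous functional calculus of positive operators\<close>

lemma tendsto_of_onorm:
  assumes "\<And>n. bounded_linear (F n)" "bounded_linear T"
    and "(\<lambda>n. onorm (\<lambda>x. F n x - T x)) \<longlonglongrightarrow> 0"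
  shows "(\<lambda>n. F n x) \<longlonglongrightarrow> T x"
proof -
  have "(\<lambda>n. F n x - T x) \<longlonglongrightarrow> 0"
  proof (rule Lim_null_comparison)
    show "\<forall>\<^sub>F n in sequentially. norm (F n x - T x) \<le> onorm (\<lambda>x. F n x - T x) * norm x"
      using onorm[OF bounded_linear_sub[OF assms(1,2)]] by simp
    show "(\<lambda>n. onorm (\<lambda>x. F n x - T x) * norm x) \<longlonglongrightarrow> 0"
      using tendsto_mult_left_zero[OF assms(3)] .
  qed
  then show ?thesis by (simp add: LIM_zero_iff)
qed

text \<open>Resolves the definite description. The differences of two approximating sequences tend
  to 0 uniformly on the spectrum, so by \<open>op_poly_norm_le\<close> the corresponding operators
  have the same limit.\<close>

lemma cfc_eqI:
  assumes A: "selfadjoint A" and T: "bounded_clinear T"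
    and p: "uniform_limit (real_spectrum A) (\<lambda>n. poly (p n)) h sequentially"
    and lim: "(\<lambda>n. onorm (\<lambda>x. op_poly (p n) A x - T x)) \<longlonglongrightarrow> 0"
  shows "cfc h A = T"
  unfolding cfc_def
proof (rule the_equality)
  show "bounded_clinear T \<and> (\<exists>p. uniform_limit (real_spectrum A) (\<lambda>n. poly (p n)) h sequentially \<and>
      (\<lambda>n. onorm (\<lambda>x. op_poly (p n) A x - T x)) \<longlonglongrightarrow> 0)"
    using T p lim by blast
  fix T' assume "bounded_clinear T' \<and>
      (\<exists>p. uniform_limit (real_spectrum A) (\<lambda>n. poly (p n)) h sequentially \<and>
      (\<lambda>n. onorm (\<lambda>x. op_poly (p n) A x - T' x)) \<longlonglongrightarrow> 0)"
  then obtain p' where T': "bounded_clinear T'"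
    and p': "uniform_limit (real_spectrum A) (\<lambda>n. poly (p' n)) h sequentially"
    and lim': "(\<lambda>n. onorm (\<lambda>x. op_poly (p' n) A x - T' x)) \<longlonglongrightarrow> 0"
    by blast
  note pA = selfadjointD(2)[OF selfadjoint_op_poly[OF A]]
  show "T' = T"
  proof
    fix x
    have "(\<lambda>n. op_poly (p' n) A x - op_poly (p n) A x) \<longlonglongrightarrow> T' x - T x"
      by (rule tendsto_diff[OF
            tendsto_of_onorm[OF pA bounded_clinear_bounded_linear[OF T'] lim']
            tendsto_of_onorm[OF pA bounded_clinear_bounded_linear[OF T] lim]])
    moreover have "(\<lambda>n. op_poly (p' n) A x - op_poly (p n) A x) \<longlonglongrightarrow> 0"
    proof (rule tendstoI)
      fix e :: real assume "0 < e"
      define d where "d = e / (norm x + 1)"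
      have "0 < d" using \<open>0 < e\<close> by (simp add: d_def add_nonneg_pos)
      have "uniform_limit (real_spectrum A) (\<lambda>n t. poly (p' n) t - poly (p n) t) (\<lambda>t. h t - h t)
          sequentially"
        by (intro uniform_limit_intros p p')
      then have "\<forall>\<^sub>F n in sequentially. \<forall>t\<in>real_spectrum A. \<bar>poly (p' n - p n) t\<bar> < d"
        using \<open>0 < d\<close> by (auto simp: uniform_limit_iff dist_norm)
      then show "\<forall>\<^sub>F n in sequentially. dist (op_poly (p' n) A x - op_poly (p n) A x) 0 < e"
      proof eventually_elim
        case (elim n)
        have "norm (op_poly (p' n - p n) A x) \<le> d * norm x"
          by (rule op_poly_norm_le[OF A]) (use elim \<open>0 < d\<close> less_imp_le in auto)
        also have "\<dots> < d * (norm x + 1)" using \<open>0 < d\<close> by simp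
        also have "\<dots> = e" by (simp add: d_def add_nonneg_eq_0_iff)
        finally show ?case by (simp add: op_poly_diff)
      qed
    qed
    ultimately have "T' x - T x = 0" by (rule LIMSEQ_unique)
    then show "T' x = T x" by simp
  qed
qed

text \<open>By \<open>op_poly_norm_le\<close>, uniform convergence on the spectrum makes the
  operators Cauchy in norm. The type of bounded linear maps provides the limit, and complex
  linearity passes to it pointwise.\<close>

lemma cfc_limit:
  fixes A :: "'a::complex_hilbert_space \<Rightarrow> 'a"
  assumes A: "selfadjoint A"
    and p: "uniform_limit (real_spectrum A) (\<lambda>n. poly (p n)) h sequentially"
  shows "bounded_clinear (cfc h A)" (is ?clin)
    and "(\<lambda>n. op_poly (p n) A x) \<longlonglongrightarrow> cfc h A x" (is ?lim)
proof -
  note pA = selfadjointD[OF selfadjoint_op_poly[OF A]]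
  define F where "F n = Blinfun (op_poly (p n) A)" for n
  have F: "blinfun_apply (F n) = op_poly (p n) A" for n
    by (simp add: F_def bounded_linear_Blinfun_apply pA)
  have "Cauchy F"
  proof (rule metric_CauchyI)
    fix e :: real assume "0 < e"
    then have "\<forall>\<^sub>F n in sequentially. \<forall>t\<in>real_spectrum A. \<bar>poly (p n) t - h t\<bar> < e / 4"
      using p[unfolded uniform_limit_iff, rule_format, of "e / 4"] by (simp add: dist_norm)
    then obtain k where k: "\<And>n t. n \<ge> k \<Longrightarrow> t \<in> real_spectrum A \<Longrightarrow> \<bar>poly (p n) t - h t\<bar> < e / 4"
      by (auto simp: eventually_sequentially)
    have "dist (F m) (F n) < e" if "k \<le> m" "k \<le> n" for m n
    proof -
      have "\<bar>poly (p m - p n) t\<bar> \<le> e / 2" if t: "t \<in> real_spectrum A" for t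
        using k[OF \<open>k \<le> m\<close> t] k[OF \<open>k \<le> n\<close> t] unfolding poly_diff by linarith
      then have "norm (op_poly (p m - p n) A x) \<le> e / 2 * norm x" for x
        using \<open>0 < e\<close> by (intro op_poly_norm_le[OF A]) auto
      then have "norm (F m - F n) \<le> e / 2"
        using \<open>0 < e\<close> by (intro norm_blinfun_bound) (simp_all add: blinfun.diff_left F op_poly_diff)
      then show ?thesis using \<open>0 < e\<close> by (simp add: dist_norm)
    qed
    then show "\<exists>k. \<forall>m\<ge>k. \<forall>n\<ge>k. dist (F m) (F n) < e" by blast
  qed
  then obtain L where L: "F \<longlonglongrightarrow> L"
    using Cauchy_convergent convergent_def by blast
  have pointwise: "(\<lambda>n. op_poly (p n) A x) \<longlonglongrightarrow> blinfun_apply L x" for x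
    using blinfun.tendsto[OF L tendsto_const, of x] by (simp add: F)
  have "blinfun_apply L (c *\<^sub>C x) = c *\<^sub>C blinfun_apply L x" for c x
    using pointwise[of "c *\<^sub>C x"] bounded_linear.tendsto[OF bounded_linear_scaleC pointwise[of x], of c]
    by (simp add: bounded_clinear_scaleC[OF pA(1)] LIMSEQ_unique)
  then have clin: "bounded_clinear (blinfun_apply L)"
    by (simp add: bounded_clinear_def blinfun.bounded_linear_right)
  have "(\<lambda>n. norm (F n - L)) \<longlonglongrightarrow> 0"
    using L by (simp add: tendsto_norm_zero LIM_zero)
  then have "(\<lambda>n. onorm (\<lambda>x. op_poly (p n) A x - blinfun_apply L x)) \<longlonglongrightarrow> 0"
    by (simp add: norm_blinfun.rep_eq minus_blinfun.rep_eq F)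
  then have "cfc h A = blinfun_apply L"
    by (rule cfc_eqI[OF A clin p])
  then show ?clin ?lim
    using clin pointwise by simp_all
qed

section \<open>Positive operators: their spectrum and approximation on an interval\<close>

definition positive_op :: "('a::complex_hilbert_space \<Rightarrow> 'a) \<Rightarrow> bool" where
  "positive_op A \<longleftrightarrow> selfadjoint A \<and> (\<forall>x. 0 \<le> inner (A x) x)"

lemma positive_op_selfadjoint: "positive_op A \<Longrightarrow> selfadjoint A"
  by (simp add: positive_op_def)

text \<open>\<open>A - t\<close> is coercive for \<open>t < 0\<close>, and \<open>t - A\<close> is
  coercive for \<open>t > onorm A\<close>. The inclusion allows Weierstrass approximation on a
  compact interval instead of on the spectrum.\<close>

lemma positive_op_real_spectrum:
  assumes "positive_op A"
  shows "real_spectrum A \<subseteq> {0..onorm A}"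
proof
  fix t assume t: "t \<in> real_spectrum A"
  note A = positive_op_selfadjoint[OF assms]
  note A' = selfadjointD[OF A]
  have "\<not> t < 0"
  proof
    assume "t < 0"
    have "- t * (norm x)\<^sup>2 \<le> 1 * inner (A x - t *\<^sub>R x) x" for x
      using assms by (simp add: positive_op_def inner_diff_left power2_norm_eq_inner)
    then have "t \<notin> real_spectrum A"
      using coercive_not_in_real_spectrum[OF A'(1), of "- t" 1 t] \<open>t < 0\<close> by simp
    then show False using t by contradiction
  qed
  moreover have "\<not> onorm A < t"
  proof
    assume less: "onorm A < t"
    have "(t - onorm A) * (norm x)\<^sup>2 \<le> - 1 * inner (A x - t *\<^sub>R x) x" for x
    proof -
      have "inner (A x) x \<le> norm (A x) * norm x" by (rule norm_cauchy_schwarz)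
      also have "\<dots> \<le> onorm A * norm x * norm x"
        by (rule mult_right_mono[OF onorm[OF A'(2)] norm_ge_zero])
      finally show ?thesis
        by (simp add: inner_diff_left power2_norm_eq_inner[symmetric] algebra_simps power2_eq_square)
    qed
    then have "t \<notin> real_spectrum A"
      by (rule coercive_not_in_real_spectrum[OF A'(1), rotated 2]) (use less in simp_all)
    then show False using t by contradiction
  qed
  ultimately show "t \<in> {0..onorm A}" by simp
qed

lemma polynomial_approximation:
  fixes h :: "real \<Rightarrow> real"
  assumes "continuous_on {0..} h"
  obtains p where "uniform_limit {0..k} (\<lambda>n. poly (p n)) h sequentially"
proof -
  have "\<exists>q. \<forall>t\<in>{0..k}. \<bar>h t - poly q t\<bar> < 1 / real (Suc n)" for n
  proof -
    have "continuous_on {0..k} h"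
      using assms by (rule continuous_on_subset) auto
    moreover have "0 < 1 / real (Suc n)" by simp
    ultimately obtain g where "real_polynomial_function g"
      and g: "\<And>t. t \<in> {0..k} \<Longrightarrow> \<bar>h t - g t\<bar> < 1 / real (Suc n)"
      using Stone_Weierstrass_real_polynomial_function[OF compact_Icc] by blast
    then obtain a m where "g = (\<lambda>x. \<Sum>i\<le>m. a i * x ^ i)"
      by (auto simp: real_polynomial_function_iff_sum)
    then have "g = poly (\<Sum>i\<le>m. monom (a i) i)"
      by (simp add: fun_eq_iff poly_sum poly_monom)
    then show ?thesis using g by blast
  qed
  then obtain p where p: "\<And>n t. t \<in> {0..k} \<Longrightarrow> \<bar>h t - poly (p n) t\<bar> < 1 / real (Suc n)"
    by metis
  have "uniform_limit {0..k} (\<lambda>n. poly (p n)) h sequentially"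
  proof (rule uniform_limitI)
    fix e :: real assume "0 < e"
    then obtain N where N: "1 / real (Suc N) < e"
      using nat_approx_posE by blast
    have "\<forall>n\<ge>N. \<forall>t\<in>{0..k}. dist (poly (p n) t) (h t) < e"
    proof (intro allI impI ballI)
      fix n t assume "N \<le> n" "t \<in> {0..k}"
      then have "\<bar>h t - poly (p n) t\<bar> < 1 / real (Suc n)" by (intro p)
      also have "\<dots> \<le> 1 / real (Suc N)" using \<open>N \<le> n\<close> by (simp add: frac_le)
      finally show "dist (poly (p n) t) (h t) < e"
        using N by (simp add: dist_norm abs_minus_commute)
    qed
    then show "\<forall>\<^sub>F n in sequentially. \<forall>t\<in>{0..k}. dist (poly (p n) t) (h t) < e"
      by (auto simp: eventually_sequentially)
  qed
  then show ?thesis by (rule that)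
qed

text \<open>The endpoint \<open>k\<close> may exceed \<open>onorm A\<close>, so that one polynomial
  sequence can serve two operators at once, as in \<open>cfc_intertwine\<close>.\<close>

lemma cfc_positive_limit:
  assumes A: "positive_op A" and "onorm A \<le> k"
    and p: "uniform_limit {0..k} (\<lambda>n. poly (p n)) h sequentially"
  shows "bounded_clinear (cfc h A)"
    and "(\<lambda>n. op_poly (p n) A x) \<longlonglongrightarrow> cfc h A x"
proof -
  have "real_spectrum A \<subseteq> {0..k}"
    using positive_op_real_spectrum[OF A] \<open>onorm A \<le> k\<close> by auto
  then have "uniform_limit (real_spectrum A) (\<lambda>n. poly (p n)) h sequentially"
    by (rule uniform_limit_on_subset[OF p])
  then show "bounded_clinear (cfc h A)" "(\<lambda>n. op_poly (p n) A x) \<longlonglongrightarrow> cfc h A x"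
    by (auto intro: cfc_limit positive_op_selfadjoint A)
qed

section \<open>Algebraic and order properties of the functional calculus\<close>

lemma selfadjoint_cfc:
  assumes A: "positive_op A" and h: "continuous_on {0..} h"
  shows "selfadjoint (cfc h A)"
proof -
  obtain p where p: "uniform_limit {0..onorm A} (\<lambda>n. poly (p n)) h sequentially"
    using polynomial_approximation[OF h] .
  note lim = cfc_positive_limit[OF A order_refl p]
  have "inner (cfc h A x) y = inner x (cfc h A y)" for x y
  proof (rule LIMSEQ_unique)
    show "(\<lambda>n. inner (op_poly (p n) A x) y) \<longlonglongrightarrow> inner (cfc h A x) y"
      by (intro tendsto_intros lim)
    show "(\<lambda>n. inner (op_poly (p n) A x) y) \<longlonglongrightarrow> inner x (cfc h A y)"
      unfolding selfadjointD(3)[OF selfadjoint_op_poly[OF positive_op_selfadjoint[OF A]]]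
      by (intro tendsto_intros lim)
  qed
  then show ?thesis
    using lim(1) by (simp add: selfadjoint_def)
qed

lemma cfc_cong:
  assumes A: "positive_op A" and "\<And>t. 0 \<le> t \<Longrightarrow> h t = h' t"
  shows "cfc h A = cfc h' A"
proof -
  have "uniform_limit (real_spectrum A) F h sequentially
      \<longleftrightarrow> uniform_limit (real_spectrum A) F h' sequentially" for F
    using positive_op_real_spectrum[OF A] assms(2) by (intro uniform_limit_cong') auto
  then show ?thesis by (simp add: cfc_def)
qed

lemma cfc_poly:
  assumes A: "positive_op A"
  shows "cfc (poly p) A = op_poly p A"
proof (rule cfc_eqI[OF positive_op_selfadjoint[OF A]])
  show "bounded_clinear (op_poly p A)"
    by (rule selfadjointD[OF selfadjoint_op_poly[OF positive_op_selfadjoint[OF A]]])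
  show "uniform_limit (real_spectrum A) (\<lambda>n. poly p) (poly p) sequentially"
    by (rule uniform_limit_const)
  show "(\<lambda>n. onorm (\<lambda>x. op_poly p A x - op_poly p A x)) \<longlonglongrightarrow> 0"
    by (simp add: onorm_zero)
qed

lemma cfc_ident:
  assumes A: "positive_op A"
  shows "cfc (\<lambda>t. t) A = A"
proof -
  note A' = selfadjointD(2)[OF positive_op_selfadjoint[OF A]]
  have "poly [:0, 1:] = (\<lambda>t::real. t)" by (simp add: fun_eq_iff)
  moreover have "op_poly [:0, 1:] A = A"
    by (simp add: fun_eq_iff op_poly_pCons[OF A'] linear_0[OF bounded_linear.linear[OF A']])
  ultimately show ?thesis using cfc_poly[OF A, of "[:0, 1:]"] by simp
qed

lemma cfc_diff:
  assumes A: "positive_op A" and h: "continuous_on {0..} h" "continuous_on {0..} h'"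
  shows "cfc (\<lambda>t. h t - h' t) A x = cfc h A x - cfc h' A x"
proof -
  obtain p where p: "uniform_limit {0..onorm A} (\<lambda>n. poly (p n)) h sequentially"
    using polynomial_approximation[OF h(1)] .
  obtain p' where p': "uniform_limit {0..onorm A} (\<lambda>n. poly (p' n)) h' sequentially"
    using polynomial_approximation[OF h(2)] .
  have "uniform_limit {0..onorm A} (\<lambda>n. poly (p n - p' n)) (\<lambda>t. h t - h' t) sequentially"
    unfolding poly_diff by (intro uniform_limit_intros p p')
  then have "(\<lambda>n. op_poly (p n - p' n) A x) \<longlonglongrightarrow> cfc (\<lambda>t. h t - h' t) A x"
    by (rule cfc_positive_limit(2)[OF A order_refl])
  moreover have "(\<lambda>n. op_poly (p n - p' n) A x) \<longlonglongrightarrow> cfc h A x - cfc h' A x"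
    unfolding op_poly_diff
    by (intro tendsto_diff cfc_positive_limit(2)[OF A order_refl p]
        cfc_positive_limit(2)[OF A order_refl p'])
  ultimately show ?thesis by (rule LIMSEQ_unique)
qed

lemma cfc_mult:
  assumes A: "positive_op A" and h: "continuous_on {0..} h" "continuous_on {0..} h'"
  shows "cfc (\<lambda>t. h t * h' t) A x = cfc h A (cfc h' A x)"
proof -
  define k where "k = onorm A"
  note A' = selfadjointD[OF positive_op_selfadjoint[OF A]]
  obtain p where p: "uniform_limit {0..k} (\<lambda>n. poly (p n)) h sequentially"
    using polynomial_approximation[OF h(1)] .
  obtain u where u: "uniform_limit {0..k} (\<lambda>n. poly (u n)) h' sequentially"
    using polynomial_approximation[OF h(2)] .
  have bdd: "bounded (w ` {0..k})" if "continuous_on {0..} w" for w :: "real \<Rightarrow> real"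
    by (intro compact_imp_bounded compact_continuous_image continuous_on_subset[OF that]) auto
  note limits = cfc_positive_limit(2)[OF A eq_refl[OF k_def[symmetric]]]
  have "uniform_limit {0..k} (\<lambda>n. poly (p n * u n)) (\<lambda>t. h t * h' t) sequentially"
    unfolding poly_mult by (intro uniform_lim_mult p u bdd h)
  then have lim: "(\<lambda>n. op_poly (p n * u n) A x) \<longlonglongrightarrow> cfc (\<lambda>t. h t * h' t) A x"
    by (rule limits)
  obtain K where "\<forall>y\<in>h ` {0..k}. norm y \<le> K"
    using bdd[OF h(1)] by (auto simp only: bounded_iff)
  then have K: "\<bar>h t\<bar> \<le> K" if "t \<in> {0..k}" for t
    using that by simp
  \<comment> \<open>Eventually \<open>p n\<close> is within 1 of \<open>h\<close> on the interval,
    so \<open>M\<close> bounds the operators \<open>p n (A)\<close> uniformly. They therefore send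
    the null sequence \<open>d\<close> to a null sequence.\<close>
  define M where "M = max 0 K + 1"
  define d where "d n = op_poly (u n) A x - cfc h' A x" for n
  have "d \<longlonglongrightarrow> 0"
    unfolding d_def using limits[OF u, of x] by (simp add: LIM_zero)
  have "(\<lambda>n. op_poly (p n) A (d n)) \<longlonglongrightarrow> 0"
  proof (rule Lim_null_comparison)
    have "\<forall>\<^sub>F n in sequentially. \<forall>t\<in>{0..k}. dist (poly (p n) t) (h t) < 1"
      using p by (auto simp: uniform_limit_iff)
    then show "\<forall>\<^sub>F n in sequentially. norm (op_poly (p n) A (d n)) \<le> M * norm (d n)"
    proof eventually_elim
      case (elim n)
      have "\<bar>poly (p n) t\<bar> \<le> M" if "t \<in> real_spectrum A" for t
      proof -
        have "t \<in> {0..k}" using that positive_op_real_spectrum[OF A] k_def by blast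
        then show ?thesis using elim K[of t] by (fastforce simp: M_def dist_norm)
      qed
      then show ?case
        by (intro op_poly_norm_le positive_op_selfadjoint A) (auto simp: M_def)
    qed
    show "(\<lambda>n. M * norm (d n)) \<longlonglongrightarrow> 0"
      using \<open>d \<longlonglongrightarrow> 0\<close> by (intro tendsto_mult_right_zero tendsto_norm_zero)
  qed
  then have "(\<lambda>n. op_poly (p n) A (d n) + op_poly (p n) A (cfc h' A x))
      \<longlonglongrightarrow> 0 + cfc h A (cfc h' A x)"
    by (intro tendsto_add limits p)
  moreover have "op_poly (p n) A (d n) + op_poly (p n) A (cfc h' A x) = op_poly (p n * u n) A x" for n
    using linear_add[OF bounded_linear.linear[OF bounded_clinear_bounded_linear[OF
          bounded_clinear_op_poly[OF A'(1)]]], of "p n" "d n" "cfc h' A x"]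
    by (simp add: d_def op_poly_mult[OF A'(2)])
  ultimately have "(\<lambda>n. op_poly (p n * u n) A x) \<longlonglongrightarrow> cfc h A (cfc h' A x)"
    by simp
  with lim show ?thesis by (rule LIMSEQ_unique)
qed

text \<open>On the interval \<open>p\<close> takes values between \<open>a\<close> and some
  \<open>K\<close>. Subtracting the midpoint leaves a polynomial of modulus at most
  \<open>(K - a) / 2\<close>, and its norm bound controls the quadratic form from below.\<close>

lemma op_poly_lower_bound:
  assumes A: "positive_op A" and a: "\<And>t. t \<in> {0..onorm A} \<Longrightarrow> a \<le> poly p t"
  shows "a * (norm x)\<^sup>2 \<le> inner (op_poly p A x) x"
proof -
  note A' = selfadjointD[OF positive_op_selfadjoint[OF A]]
  have "0 \<le> onorm A" by (rule onorm_pos_le) (rule A')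
  have "bounded (poly p ` {0..onorm A})"
    by (intro compact_imp_bounded compact_continuous_image continuous_intros) auto
  then obtain K where "\<forall>y\<in>poly p ` {0..onorm A}. norm y \<le> K"
    by (auto simp only: bounded_iff)
  then have K: "\<bar>poly p t\<bar> \<le> K" if "t \<in> {0..onorm A}" for t
    using that by simp
  have "a \<le> K" using a[of 0] K[of 0] \<open>0 \<le> onorm A\<close> by auto
  define q where "q = p - [:(K + a) / 2:]"
  have "\<bar>poly q t\<bar> \<le> (K - a) / 2" if "t \<in> real_spectrum A" for t
  proof -
    have "t \<in> {0..onorm A}" using that positive_op_real_spectrum[OF A] by blast
    then show ?thesis
      using a[of t] K[of t] unfolding abs_le_iff by (auto simp: q_def field_simps)
  qed
  then have "norm (op_poly q A x) \<le> (K - a) / 2 * norm x"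
    using \<open>a \<le> K\<close> by (intro op_poly_norm_le positive_op_selfadjoint A) auto
  then have "\<bar>inner (op_poly q A x) x\<bar> \<le> (K - a) / 2 * norm x * norm x"
    using Cauchy_Schwarz_ineq2[of "op_poly q A x" x] mult_right_mono[OF _ norm_ge_zero[of x]]
    by (meson order_trans)
  moreover have "op_poly q A x = op_poly p A x - ((K + a) / 2) *\<^sub>R x"
    by (simp add: q_def op_poly_diff op_poly_pCons[OF A'(2)] linear_0[OF bounded_linear.linear[OF A'(2)]])
  ultimately show ?thesis
    by (simp add: inner_diff_left power2_norm_eq_inner[symmetric] power2_eq_square field_simps abs_le_iff)
qed

lemma cfc_mono:
  assumes A: "positive_op A" and h: "continuous_on {0..} h" "continuous_on {0..} h'"
    and le: "\<And>t. 0 \<le> t \<Longrightarrow> h t \<le> h' t"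
  shows "inner (cfc h A x) x \<le> inner (cfc h' A x) x"
proof -
  define u where "u t = h' t - h t" for t
  have u: "continuous_on {0..} u" unfolding u_def by (intro continuous_intros h)
  obtain p where p: "uniform_limit {0..onorm A} (\<lambda>n. poly (p n)) u sequentially"
    using polynomial_approximation[OF u] .
  have lim: "(\<lambda>n. inner (op_poly (p n) A x) x) \<longlonglongrightarrow> inner (cfc u A x) x"
    by (intro tendsto_intros cfc_positive_limit[OF A order_refl p])
  \<comment> \<open>The approximants of the non-negative \<open>u\<close> may dip below 0, but
    eventually not below \<open>-e\<close>.\<close>
  have "- e * (norm x)\<^sup>2 \<le> inner (cfc u A x) x" if "0 < e" for e
  proof (rule tendsto_lowerbound[OF lim])
    have "\<forall>\<^sub>F n in sequentially. \<forall>t\<in>{0..onorm A}. dist (poly (p n) t) (u t) < e"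
      using p \<open>0 < e\<close> by (auto simp: uniform_limit_iff)
    then show "\<forall>\<^sub>F n in sequentially. - e * (norm x)\<^sup>2 \<le> inner (op_poly (p n) A x) x"
    proof eventually_elim
      case (elim n)
      show ?case
      proof (rule op_poly_lower_bound[OF A])
        fix t assume t: "t \<in> {0..onorm A}"
        then have "\<bar>poly (p n) t - u t\<bar> < e" using elim by (simp add: dist_norm)
        moreover have "0 \<le> u t" using t le[of t] by (simp add: u_def)
        ultimately show "- e \<le> poly (p n) t" by linarith
      qed
    qed
  qed simp
  then have "0 \<le> inner (cfc u A x) x + e * (norm x)\<^sup>2" if "0 < e" for e
    using that by fastforce
  then have "0 \<le> inner (cfc u A x) x"
  proof -
    have "0 \<le> inner (cfc u A x) x + e" if "0 < e" for e
    proof (cases "x = 0")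
      case False
      then show ?thesis
        using \<open>\<And>e. 0 < e \<Longrightarrow> 0 \<le> inner (cfc u A x) x + e * (norm x)\<^sup>2\<close>[of "e / (norm x)\<^sup>2"] that
        by simp
    qed (use that in simp)
    then show ?thesis by (rule field_le_epsilon)
  qed
  then show ?thesis
    using cfc_diff[OF A h(2,1), of x] by (simp add: u_def[abs_def] inner_diff_left)
qed

lemma positive_op_cfc:
  assumes A: "positive_op A" and h: "continuous_on {0..} h" and "\<And>t. 0 \<le> t \<Longrightarrow> 0 \<le> h t"
  shows "positive_op (cfc h A)"
proof -
  have "poly 0 = (\<lambda>t::real. 0)" by (simp add: fun_eq_iff)
  then have "cfc (\<lambda>t. 0) A x = 0" for x
    using cfc_poly[OF A, of 0] by simp
  then have "0 \<le> inner (cfc h A x) x" for x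
    using cfc_mono[OF A continuous_on_const h assms(3), of x] by simp
  then show ?thesis
    using selfadjoint_cfc[OF A h] by (simp add: positive_op_def)
qed

text \<open>The squared norm of \<open>u(A) x\<close> is the quadratic form of
  \<open>u^2 (A)\<close> at \<open>x\<close>, so monotonicity applies to the squared
  functions.\<close>

lemma norm_cfc_le:
  assumes A: "positive_op A" and h: "continuous_on {0..} h" "continuous_on {0..} h'"
    and le: "\<And>t. 0 \<le> t \<Longrightarrow> \<bar>h t\<bar> \<le> \<bar>h' t\<bar>"
  shows "norm (cfc h A x) \<le> norm (cfc h' A x)"
proof -
  have sq: "(norm (cfc u A x))\<^sup>2 = inner (cfc (\<lambda>t. u t * u t) A x) x"
    if "continuous_on {0..} u" for u
    unfolding power2_norm_eq_inner cfc_mult[OF A that that]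
    by (rule selfadjointD(3)[OF selfadjoint_cfc[OF A that], symmetric])
  have "(norm (cfc h A x))\<^sup>2 \<le> (norm (cfc h' A x))\<^sup>2"
    unfolding sq[OF h(1)] sq[OF h(2)]
    using le by (intro cfc_mono A continuous_intros h) (metis abs_le_square_iff power2_eq_square)
  then show ?thesis by (rule power2_le_imp_le) simp
qed

text \<open>Polynomials approximating \<open>h\<close> on an interval that contains both spectra
  intertwine exactly, and the relation passes to the limit.\<close>

lemma cfc_intertwine:
  assumes A: "positive_op A" and D: "positive_op D" and B: "bounded_linear B"
    and comm: "\<And>x. B (A x) = D (B x)" and h: "continuous_on {0..} h"
  shows "B (cfc h A x) = cfc h D (B x)"
proof -
  define k where "k = max (onorm A) (onorm D)"
  have k: "onorm A \<le> k" "onorm D \<le> k" by (simp_all add: k_def)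
  obtain p where p: "uniform_limit {0..k} (\<lambda>n. poly (p n)) h sequentially"
    using polynomial_approximation[OF h] .
  have lim: "(\<lambda>n. B (op_poly (p n) A x)) \<longlonglongrightarrow> B (cfc h A x)"
    by (intro bounded_linear.tendsto[OF B] cfc_positive_limit[OF A k(1) p])
  have "B (op_poly (p n) A x) = op_poly (p n) D (B x)" for n
    by (intro op_poly_intertwine selfadjointD[OF positive_op_selfadjoint] A D B comm)
  then have "(\<lambda>n. B (op_poly (p n) A x)) \<longlonglongrightarrow> cfc h D (B x)"
    using cfc_positive_limit(2)[OF D k(2) p] by simp
  with lim show ?thesis by (rule LIMSEQ_unique)
qed

section \<open>The absolute value and the mixed Schwarz inequality\<close>

lemma continuous_on_powr_nonneg: "0 < s \<Longrightarrow> continuous_on {0..} (\<lambda>t::real. t powr s)"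
  by (intro continuous_on_powr') (auto intro: continuous_intros)

lemma positive_op_cadjoint_comp:
  assumes "bounded_clinear B"
  shows "positive_op (\<lambda>x. cadjoint B (B x))"
proof -
  have "inner (cadjoint B (B x)) y = inner (B x) (B y)" for x y
    using inner_cadjoint[OF assms, of y "B x"] by (simp add: inner_commute)
  moreover have "inner x (cadjoint B (B y)) = inner (B x) (B y)" for x y
    by (rule inner_cadjoint[OF assms, symmetric])
  ultimately show ?thesis
    by (simp add: positive_op_def selfadjoint_def
        bounded_clinear_compose[OF bounded_clinear_cadjoint[OF assms] assms])
qed

lemma positive_op_op_abs:
  assumes "bounded_clinear B"
  shows "positive_op (op_abs B)"
  unfolding op_abs_def op_powr_def
  by (intro positive_op_cfc positive_op_cadjoint_comp assms continuous_on_powr_nonneg) auto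

lemma op_abs_op_abs:
  assumes "bounded_clinear B"
  shows "op_abs B (op_abs B x) = cadjoint B (B x)"
proof -
  note pos = positive_op_cadjoint_comp[OF assms]
  have "op_abs B (op_abs B x)
      = cfc (\<lambda>t. t powr (1/2) * t powr (1/2)) (\<lambda>x. cadjoint B (B x)) x"
    unfolding op_abs_def op_powr_def
    by (rule cfc_mult[OF pos, symmetric]) (simp_all add: continuous_on_powr_nonneg)
  also have "cfc (\<lambda>t. t powr (1/2) * t powr (1/2)) (\<lambda>x. cadjoint B (B x))
      = cfc (\<lambda>t. t) (\<lambda>x. cadjoint B (B x))"
    by (rule cfc_cong[OF pos]) (simp add: powr_add[symmetric])
  finally show ?thesis by (simp add: cfc_ident[OF pos])
qed

lemma norm_op_abs:
  assumes "bounded_clinear B"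
  shows "norm (op_abs B x) = norm (B x)"
proof -
  have "inner (op_abs B x) (op_abs B x) = inner x (op_abs B (op_abs B x))"
    by (rule selfadjointD(3)[OF positive_op_selfadjoint[OF positive_op_op_abs[OF assms]]])
  also have "\<dots> = inner (B x) (B x)"
    by (simp add: op_abs_op_abs[OF assms] inner_cadjoint[OF assms])
  finally show ?thesis by (simp add: norm_eq_sqrt_inner)
qed

text \<open>Composing \<open>B\<close> with \<open>cadjoint B\<close> and \<open>B\<close> again can
  be bracketed in two ways; this intertwining of the two products passes to their square
  roots.\<close>

lemma op_abs_intertwine:
  assumes "bounded_clinear B"
  shows "B (op_abs B x) = op_abs (cadjoint B) (B x)"
  unfolding op_abs_def op_powr_def cadjoint_cadjoint[OF assms]
  using positive_op_cadjoint_comp[OF bounded_clinear_cadjoint[OF assms]]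
  by (intro cfc_intertwine positive_op_cadjoint_comp bounded_clinear_bounded_linear assms
      continuous_on_powr_nonneg) (simp_all add: cadjoint_cadjoint[OF assms])

text \<open>The operator \<open>B (|B| + e)\<^sup>-\<^sup>1\<close> is a contraction that plays the role of the partial isometry
  of the polar decomposition of \<open>B\<close>, up to an error of norm at most \<open>e\<close>.\<close>

lemma mixed_schwarz:
  assumes B: "bounded_clinear B"
    and f: "continuous_on {0..} f" and g: "continuous_on {0..} g"
    and fg: "\<And>t. 0 \<le> t \<Longrightarrow> f t * g t = t"
  shows "cmod (cinner (B x) y) \<le> norm (cfc f (op_abs B) x) * norm (cfc g (op_abs (cadjoint B)) y)"
proof -
  define P where "P = op_abs B"
  define Q where "Q = op_abs (cadjoint B)"
  interpret bounded_linear B using B by (rule bounded_clinear_bounded_linear)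
  have P: "positive_op P" and Q: "positive_op Q"
    unfolding P_def Q_def by (intro positive_op_op_abs bounded_clinear_cadjoint B)+
  have normP: "norm (P x) = norm (B x)" for x
    unfolding P_def by (rule norm_op_abs[OF B])
  have BP: "B (P x) = Q (B x)" for x
    unfolding P_def Q_def by (rule op_abs_intertwine[OF B])
  have eps: "inner (B x) y \<le> norm (cfc f P x) * norm (cfc g Q y) + e * (norm x * norm y)"
    if "0 < e" for e x y
  proof -
    \<comment> \<open>\<open>k(P)\<close> is the inverse of \<open>P + e\<close>. For
      \<open>w = k(P) f(P) x\<close>, the relation \<open>f t * g t = t\<close> makes
      \<open>g(P) w = P k(P) x\<close> an approximation of \<open>x\<close>, while
      \<open>B w\<close> stays bounded in norm by \<open>f(P) x\<close>.\<close>
    define k where "k t = 1 / (t + e)" for t :: real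
    have k: "continuous_on {0..} k"
      unfolding k_def using \<open>0 < e\<close> by (intro continuous_intros) auto
    note mult = cfc_mult[OF P]
    define w where "w = cfc k P (cfc f P x)"
    have "cfc g P w = cfc (\<lambda>t. g t * (k t * f t)) P x"
      unfolding w_def
      by (subst mult[OF g], intro continuous_intros k f, subst mult[OF k f], rule refl)
    also have "\<dots> = cfc (\<lambda>t. t * k t) P x"
      by (rule fun_cong[OF cfc_cong[OF P]]) (use fg in \<open>simp add: mult_ac\<close>)
    finally have gw: "cfc g P w = cfc (\<lambda>t. t * k t) P x" .
    have "norm (B w) = norm (P w)" by (simp add: normP)
    also have "P w = cfc (\<lambda>t. t * (k t * f t)) P x"
      unfolding w_def
      by (subst mult, intro continuous_intros, intro continuous_intros k f, subst mult[OF k f])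
        (simp add: cfc_ident[OF P])
    also have "norm \<dots> \<le> norm (cfc f P x)"
    proof (rule norm_cfc_le[OF P _ f])
      show "continuous_on {0..} (\<lambda>t. t * (k t * f t))"
        by (intro continuous_intros k f)
      fix t :: real assume "0 \<le> t"
      then have "\<bar>t * k t\<bar> \<le> 1" using \<open>0 < e\<close> by (simp add: k_def)
      then show "\<bar>t * (k t * f t)\<bar> \<le> \<bar>f t\<bar>"
        using mult_right_mono[of "\<bar>t * k t\<bar>" 1 "\<bar>f t\<bar>"] by (simp add: abs_mult mult_ac)
    qed
    finally have Bw: "norm (B w) \<le> norm (cfc f P x)" .
    \<comment> \<open>The error of the approximation:
      \<open>t - t^2 / (t + e) = e t / (t + e)\<close>, which is at most \<open>e\<close> on the
      half-line.\<close>
    have "norm (B (x - cfc g P w)) = norm (P (x - cfc g P w))" by (simp add: normP)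
    also have "P (x - cfc g P w) = cfc (\<lambda>t. t - t * (t * k t)) P x"
    proof -
      have "P (cfc (\<lambda>t. t * k t) P x) = cfc (\<lambda>t. t * (t * k t)) P x"
        by (subst mult, intro continuous_intros, intro continuous_intros k)
          (simp add: cfc_ident[OF P])
      moreover have "cfc (\<lambda>t. t - t * (t * k t)) P x = P x - cfc (\<lambda>t. t * (t * k t)) P x"
        by (subst cfc_diff[OF P], intro continuous_intros, intro continuous_intros k)
          (simp add: cfc_ident[OF P])
      ultimately show ?thesis
        by (simp add: gw linear_diff[OF bounded_linear.linear[OF
              selfadjointD(2)[OF positive_op_selfadjoint[OF P]]]])
    qed
    also have "norm \<dots> \<le> norm (cfc (\<lambda>t. e) P x)"
    proof (rule norm_cfc_le[OF P])
      show "continuous_on {0..} (\<lambda>t. t - t * (t * k t))"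
        by (intro continuous_intros k)
      fix t :: real assume "0 \<le> t"
      have "t - t * (t * k t) = e * (t * k t)"
        using \<open>0 < e\<close> \<open>0 \<le> t\<close> by (simp add: k_def field_simps)
      moreover have "\<bar>t * k t\<bar> \<le> 1" using \<open>0 < e\<close> \<open>0 \<le> t\<close> by (simp add: k_def)
      ultimately show "\<bar>t - t * (t * k t)\<bar> \<le> \<bar>e\<bar>"
        using \<open>0 < e\<close> mult_left_mono[of "\<bar>t * k t\<bar>" 1 e] by (simp add: abs_mult)
    qed simp
    also have "cfc (\<lambda>t. e) P x = e *\<^sub>R x"
    proof -
      note P' = selfadjointD(2)[OF positive_op_selfadjoint[OF P]]
      have "cfc (poly [:e:]) P x = e *\<^sub>R x"
        unfolding cfc_poly[OF P]
        by (simp add: op_poly_pCons[OF P'] linear_0[OF bounded_linear.linear[OF P']])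
      moreover have "poly [:e:] = (\<lambda>t. e)" by (simp add: fun_eq_iff)
      ultimately show ?thesis by simp
    qed
    finally have rest: "norm (B (x - cfc g P w)) \<le> e * norm x"
      using \<open>0 < e\<close> by simp
    \<comment> \<open>Intertwining turns \<open>g(P)\<close> into \<open>g(Q)\<close> on the other
      side of \<open>B\<close>, from where self-adjointness moves it onto \<open>y\<close>.\<close>
    have "B (cfc g P w) = cfc g Q (B w)"
      by (rule cfc_intertwine[OF P Q bounded_linear_axioms BP g])
    then have "inner (B (cfc g P w)) y = inner (B w) (cfc g Q y)"
      by (simp add: selfadjointD(3)[OF selfadjoint_cfc[OF Q g]])
    also have "\<dots> \<le> norm (B w) * norm (cfc g Q y)" by (rule norm_cauchy_schwarz)
    also have "\<dots> \<le> norm (cfc f P x) * norm (cfc g Q y)"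
      by (rule mult_right_mono[OF Bw norm_ge_zero])
    finally have main: "inner (B (cfc g P w)) y \<le> norm (cfc f P x) * norm (cfc g Q y)" .
    have "inner (B (x - cfc g P w)) y \<le> norm (B (x - cfc g P w)) * norm y"
      by (rule norm_cauchy_schwarz)
    also have "\<dots> \<le> e * norm x * norm y"
      by (rule mult_right_mono[OF rest norm_ge_zero])
    finally show ?thesis
      using main by (simp add: diff inner_diff_left)
  qed
  have real_part: "inner (B x) y \<le> norm (cfc f P x) * norm (cfc g Q y)" for x y
  proof (rule field_le_epsilon)
    fix d :: real assume "0 < d"
    define n where "n = norm x * norm y + 1"
    have "0 < n" by (simp add: n_def add_nonneg_pos)
    have "d / n * (norm x * norm y) \<le> d / n * n"
      using \<open>0 < d\<close> \<open>0 < n\<close> by (intro mult_left_mono) (auto simp: n_def)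
    then show "inner (B x) y \<le> norm (cfc f P x) * norm (cfc g Q y) + d"
      using eps[of "d / n" x y] \<open>0 < d\<close> \<open>0 < n\<close> by simp
  qed
  obtain c where c: "cmod c = 1" "cmod (cinner (B x) y) = inner (c *\<^sub>C B x) y"
    by (rule cmod_cinner_rotate)
  have "cmod (cinner (B x) y) = inner (B (c *\<^sub>C x)) y"
    by (simp add: c bounded_clinear_scaleC[OF B])
  also have "\<dots> \<le> norm (cfc f P (c *\<^sub>C x)) * norm (cfc g Q y)"
    by (rule real_part)
  also have "cfc f P (c *\<^sub>C x) = c *\<^sub>C cfc f P x"
    by (rule bounded_clinear_scaleC[OF selfadjointD(1)[OF selfadjoint_cfc[OF P f]]])
  finally show ?thesis
    by (simp add: norm_scaleC c P_def Q_def)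
qed

section \<open>The McCarthy inequality and the numerical radius\<close>

text \<open>The tangent line at \<open>m\<close> lies below the convex power function. Convexity is
  used on the open half-line, so \<open>v = 0\<close> is treated apart.\<close>

lemma powr_tangent:
  fixes v m r :: real
  assumes "1 \<le> r" "0 < m" "0 \<le> v"
  shows "r * m powr (r - 1) * v - (r - 1) * m powr r \<le> v powr r"
proof (cases "v = 0")
  case False
  have "r * m powr (r - 1) * (v - m) \<le> v powr r - m powr r"
    using assms False
    by (intro convex_on_imp_above_tangent[of "{0<..}"] powr_convex)
      (auto simp: interior_open intro!: derivative_eq_intros)
  moreover have "r * m powr (r - 1) * (v - m) = r * m powr (r - 1) * v - r * m powr r"
    using \<open>0 < m\<close> by (simp add: right_diff_distrib powr_diff)
  ultimately show ?thesis
    by (simp add: left_diff_distrib)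
qed (use assms in simp)

text \<open>Add the tangent estimates at the midpoint \<open>m\<close> for \<open>a\<close> and
  \<open>b\<close>: the linear terms sum to \<open>2 r m^r\<close>, leaving \<open>2 m^r\<close> on
  the left.\<close>

lemma powr_add_le:
  fixes a b r :: real
  assumes "1 \<le> r" "0 \<le> a" "0 \<le> b"
  shows "(a + b) powr r \<le> 2 powr (r - 1) * (a powr r + b powr r)"
proof (cases "a + b = 0")
  case False
  define m where "m = (a + b) / 2"
  have "0 < m" using assms False by (simp add: m_def)
  have "r * m powr (r - 1) * a + r * m powr (r - 1) * b = r * m powr (r - 1) * (2 * m)"
    unfolding distrib_left[symmetric] by (simp add: m_def)
  also have "\<dots> = 2 * r * m powr r"
    using \<open>0 < m\<close> by (simp add: powr_diff)
  finally have "r * m powr (r - 1) * a + r * m powr (r - 1) * b = 2 * r * m powr r" .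
  then have "2 * m powr r \<le> a powr r + b powr r"
    using powr_tangent[OF \<open>1 \<le> r\<close> \<open>0 < m\<close> \<open>0 \<le> a\<close>] powr_tangent[OF \<open>1 \<le> r\<close> \<open>0 < m\<close> \<open>0 \<le> b\<close>]
    by (simp add: algebra_simps)
  moreover have "2 powr (r - 1) * (2 * m powr r) = (a + b) powr r"
    using assms by (simp add: m_def powr_divide powr_diff)
  ultimately show ?thesis
    by (metis mult_left_mono powr_ge_zero)
qed (use assms in simp)

text \<open>With \<open>m = \<parallel>S x\<parallel>\<^sup>2 / \<parallel>x\<parallel>\<^sup>2\<close>, the functional calculus applied to the tangent line
  of \<open>u powr r\<close> at \<open>u = m\<close>, \<open>u = t\<^sup>2\<close>.\<close>

lemma mccarthy:
  assumes S: "positive_op S" and r: "1 \<le> r"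
  shows "((norm (S x))\<^sup>2) powr r \<le> ((norm x)\<^sup>2) powr (r - 1) * inner (op_powr S (2 * r) x) x"
\<comment> \<open>If \<open>S x = 0\<close>, the point of tangency would be 0, outside the range of
  \<open>powr_tangent\<close>; then the left side is \<open>0 powr r = 0\<close>.\<close>
proof (cases "S x = 0")
  case True
  have "positive_op (op_powr S (2 * r))"
    unfolding op_powr_def using r by (intro positive_op_cfc S continuous_on_powr_nonneg) auto
  then show ?thesis
    using True by (simp add: positive_op_def)
next
  case False
  note S' = selfadjointD[OF positive_op_selfadjoint[OF S]]
  note S0 = linear_0[OF bounded_linear.linear[OF S'(2)]]
  have "x \<noteq> 0" using False S0 by auto
  define u where "u = (norm (S x))\<^sup>2"
  define n where "n = (norm x)\<^sup>2"
  define m where "m = u / n"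
  have pos: "0 < u" "0 < n" "0 < m"
    using False \<open>x \<noteq> 0\<close> by (simp_all add: u_def n_def m_def)
  \<comment> \<open>\<open>a v + b\<close> is the tangent line at \<open>v = m\<close>, and
    \<open>q\<close> is this line at \<open>v = t^2\<close>. Since \<open>u = m * n\<close>, the
    quadratic form of \<open>q(S)\<close> at \<open>x\<close> is \<open>n\<close> times the value at
    the point of tangency.\<close>
  define a where "a = r * m powr (r - 1)"
  define b where "b = - (r - 1) * m powr r"
  define q where "q = [:b, 0, a:]"
  have "inner (cfc (poly q) S x) x \<le> inner (op_powr S (2 * r) x) x"
    unfolding op_powr_def
  proof (rule cfc_mono[OF S])
    show "continuous_on {0..} (poly q)" by (intro continuous_intros)
    show "continuous_on {0..} (\<lambda>t. t powr (2 * r))"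
      using r by (intro continuous_on_powr_nonneg) simp
    fix t :: real assume "0 \<le> t"
    then have "(t\<^sup>2) powr r = t powr (2 * r)"
      by (simp add: powr_powr[symmetric])
    then show "poly q t \<le> t powr (2 * r)"
      using powr_tangent[OF r pos(3), of "t\<^sup>2"]
      by (simp add: q_def a_def b_def power2_eq_square algebra_simps)
  qed
  moreover have "inner (cfc (poly q) S x) x = a * u + b * n"
  proof -
    have "op_poly q S x = b *\<^sub>R x + a *\<^sub>R S (S x)"
      by (simp add: q_def op_poly_pCons[OF S'(2)] S0
          linear_scale[OF bounded_linear.linear[OF S'(2)]])
    then have "inner (op_poly q S x) x = b * inner x x + a * inner (S (S x)) x"
      by (simp add: inner_add_left)
    also have "inner (S (S x)) x = inner (S x) (S x)" by (rule S'(3))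
    finally show ?thesis
      by (simp add: cfc_poly[OF S] u_def n_def power2_norm_eq_inner)
  qed
  moreover have "a * u + b * n = m powr r * n"
  proof -
    have "u = m * n" using pos by (simp add: m_def)
    moreover have "m powr (r - 1) * m = m powr r"
      using pos by (simp add: powr_mult_base mult.commute)
    ultimately have "a * u = r * m powr r * n"
      by (simp add: a_def)
    then show ?thesis by (simp add: b_def algebra_simps)
  qed
  ultimately have "m powr r * n \<le> inner (op_powr S (2 * r) x) x" by simp
  then have "n powr (r - 1) * (m powr r * n) \<le> n powr (r - 1) * inner (op_powr S (2 * r) x) x"
    by (rule mult_left_mono) simp
  moreover have "n powr (r - 1) * (m powr r * n) = u powr r"
    using pos by (simp add: m_def powr_divide powr_diff)
  ultimately show ?thesis
    by (simp add: u_def n_def)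
qed

section \<open>Quadratic forms bounded by the numerical radius\<close>

lemma
  assumes A: "bounded_clinear A"
  shows numerical_radius_nonneg: "0 \<le> numerical_radius A"
    and inner_le_numerical_radius: "inner (A x) x \<le> numerical_radius A * (norm x)\<^sup>2"
proof -
  interpret bounded_linear A using A by (rule bounded_clinear_bounded_linear)
  define N where "N = {cmod (cinner (A x) x) | x. norm x = 1}"
  have "cmod (cinner (A x) x) \<le> onorm A" if "norm x = 1" for x
    using cmod_cinner_le[of "A x" x] onorm[OF bounded_linear_axioms, of x] that by simp
  then have bdd: "bdd_above (insert 0 N)"
    using onorm_pos_le[OF bounded_linear_axioms] by (intro bdd_aboveI[of _ "onorm A"]) (auto simp: N_def)
  show "0 \<le> numerical_radius A"
    unfolding numerical_radius_def N_def[symmetric] by (rule cSup_upper[OF _ bdd]) simp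
  show "inner (A x) x \<le> numerical_radius A * (norm x)\<^sup>2"
  proof (cases "x = 0")
    case False
    define e where "e = (1 / norm x) *\<^sub>R x"
    have x: "x = norm x *\<^sub>R e" and "norm e = 1" using False by (simp_all add: e_def)
    then have "cmod (cinner (A e) e) \<le> numerical_radius A"
      unfolding numerical_radius_def N_def[symmetric]
      by (intro cSup_upper[OF _ bdd]) (auto simp: N_def)
    moreover have "inner (A e) e \<le> cmod (cinner (A e) e)"
      unfolding inner_eq_Re_cinner by (rule complex_Re_le_cmod)
    ultimately have "inner (A e) e * (norm x)\<^sup>2 \<le> numerical_radius A * (norm x)\<^sup>2"
      by (intro mult_right_mono) auto
    moreover have "inner (A x) x = inner (A e) e * (norm x)\<^sup>2"
      by (subst (1 2) x) (simp add: scaleR power2_eq_square)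
    ultimately show ?thesis by simp
  qed (simp add: zero)
qed

text \<open>Treats one of the two factors in the final estimate: \<open>powr_add_le\<close> splits
  the sum, \<open>mccarthy\<close> handles each term, and the numerical radius bounds the recombined
  quadratic form.\<close>

lemma sum_norm_sq_powr_le:
  assumes S: "positive_op S" and S': "positive_op S'" and r: "1 \<le> r"
  defines "W \<equiv> numerical_radius (\<lambda>x. op_powr S (2 * r) x + op_powr S' (2 * r) x)"
  shows "0 \<le> W"
    and "((norm (S x))\<^sup>2 + (norm (S' x))\<^sup>2) powr r \<le> 2 powr (r - 1) * W * ((norm x)\<^sup>2) powr r"
proof -
  have "bounded_clinear (op_powr S (2 * r))" "bounded_clinear (op_powr S' (2 * r))"
    unfolding op_powr_def using r
    by (auto intro!: selfadjointD(1) selfadjoint_cfc S S' continuous_on_powr_nonneg)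
  then have clin: "bounded_clinear (\<lambda>x. op_powr S (2 * r) x + op_powr S' (2 * r) x)"
    by (rule bounded_clinear_add)
  show "0 \<le> W" unfolding W_def by (rule numerical_radius_nonneg[OF clin])
  define n where "n = (norm x)\<^sup>2"
  have "((norm (S x))\<^sup>2 + (norm (S' x))\<^sup>2) powr r
      \<le> 2 powr (r - 1) * (((norm (S x))\<^sup>2) powr r + ((norm (S' x))\<^sup>2) powr r)"
    by (rule powr_add_le[OF r]) auto
  also have "\<dots> \<le> 2 powr (r - 1) * (n powr (r - 1) * inner (op_powr S (2 * r) x) x
      + n powr (r - 1) * inner (op_powr S' (2 * r) x) x)"
    unfolding n_def by (intro mult_left_mono add_mono mccarthy S S' r) simp
  also have "\<dots> = 2 powr (r - 1) * (n powr (r - 1)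
      * inner (op_powr S (2 * r) x + op_powr S' (2 * r) x) x)"
    by (simp add: inner_add_left distrib_left)
  also have "\<dots> \<le> 2 powr (r - 1) * (n powr (r - 1) * (W * n))"
    unfolding n_def W_def by (intro mult_left_mono inner_le_numerical_radius[OF clin]) simp_all
  also have "\<dots> = 2 powr (r - 1) * W * n powr r"
    by (cases "n = 0") (simp_all add: n_def powr_diff)
  finally show "((norm (S x))\<^sup>2 + (norm (S' x))\<^sup>2) powr r
      \<le> 2 powr (r - 1) * W * ((norm x)\<^sup>2) powr r"
    by (simp add: n_def)
qed

section \<open>The inequality for the off-diagonal operator matrix\<close>

theorem theorem3p5:
  fixes B :: "'b::complex_hilbert_space \<Rightarrow> 'a::complex_hilbert_space"
    and C :: "'a \<Rightarrow> 'b"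
    and f g :: "real \<Rightarrow> real"
    and r :: real
  assumes "bounded_clinear B" and "bounded_clinear C"
    and "r \<ge> 1"
    and "continuous_on {0..} f" and "continuous_on {0..} g"
    and "\<And>t. t \<ge> 0 \<Longrightarrow> f t \<ge> 0" and "\<And>t. t \<ge> 0 \<Longrightarrow> g t \<ge> 0"
    and "\<And>t. t \<ge> 0 \<Longrightarrow> f t * g t = t"
  shows "numerical_radius (op_matrix (\<lambda>_. 0) B C (\<lambda>_. 0)) powr r
    \<le> 2 powr (r - 2)
      * numerical_radius (\<lambda>x. op_powr (cfc f (op_abs B)) (2 * r) x
                            + op_powr (cfc g (op_abs (cadjoint C))) (2 * r) x) powr (1/2)
      * numerical_radius (\<lambda>x. op_powr (cfc f (op_abs C)) (2 * r) x
                            + op_powr (cfc g (op_abs (cadjoint B))) (2 * r) x) powr (1/2)"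
    (is "numerical_radius ?T powr r \<le> 2 powr (r - 2) * ?W1 powr (1/2) * ?W2 powr (1/2)")
proof -
  note B = assms(1) and C = assms(2) and r = assms(3) and f = assms(4) and g = assms(5)
  define S1 where "S1 = cfc f (op_abs B)"
  define S1' where "S1' = cfc g (op_abs (cadjoint C))"
  define S2 where "S2 = cfc f (op_abs C)"
  define S2' where "S2' = cfc g (op_abs (cadjoint B))"
  have pos: "positive_op S1" "positive_op S1'" "positive_op S2" "positive_op S2'"
    unfolding S1_def S1'_def S2_def S2'_def
    by (simp_all add: positive_op_cfc positive_op_op_abs bounded_clinear_cadjoint B C f g assms(6,7))
  define W1 where "W1 = ?W1"
  define W2 where "W2 = ?W2"
  note bound1 = sum_norm_sq_powr_le[OF pos(1,2) r, folded W1_def[unfolded S1_def[symmetric] S1'_def[symmetric]]]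
  note bound2 = sum_norm_sq_powr_le[OF pos(3,4) r, folded W2_def[unfolded S2_def[symmetric] S2'_def[symmetric]]]
  define R where "R = 2 powr (r - 2) * W1 powr (1/2) * W2 powr (1/2)"
  have "0 \<le> R" by (simp add: R_def)
  have unit: "cmod (cinner (?T z) z) powr r \<le> R" if "norm z = 1" for z
  proof -
    obtain x y where z: "z = (x, y)" by (cases z)
    define L where "L = cmod (cinner (?T z) z)"
    define U where "U = (norm (S1 y))\<^sup>2 + (norm (S1' y))\<^sup>2"
    define V where "V = (norm (S2 x))\<^sup>2 + (norm (S2' x))\<^sup>2"
    have nonneg: "0 \<le> L" "0 \<le> U" "0 \<le> V" by (simp_all add: L_def U_def V_def)
    have "L \<le> cmod (cinner (B y) x) + cmod (cinner (C x) y)"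
      by (simp add: L_def z op_matrix_def cinner_prod_def norm_triangle_ineq)
    also have "\<dots> \<le> norm (S1 y) * norm (S2' x) + norm (S2 x) * norm (S1' y)"
      unfolding S1_def S1'_def S2_def S2'_def
      using mixed_schwarz[OF B f g assms(8)] mixed_schwarz[OF C f g assms(8)] by (rule add_mono)
    finally have L: "L \<le> norm (S1 y) * norm (S2' x) + norm (S2 x) * norm (S1' y)" .
    have "L\<^sup>2 \<le> (norm (S1 y) * norm (S2' x) + norm (S2 x) * norm (S1' y))\<^sup>2"
      by (rule power_mono[OF L nonneg(1)])
    also have "\<dots> \<le> U * V"
      \<comment> \<open>Lagrange's identity: the difference of the two sides is exactly this
        square.\<close>
      using zero_le_power2[of "norm (S1 y) * norm (S2 x) - norm (S1' y) * norm (S2' x)"]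
      unfolding U_def V_def by (simp add: power2_eq_square algebra_simps)
    finally have "(L\<^sup>2) powr r \<le> (U * V) powr r"
      using r by (intro powr_mono2) auto
    also have "\<dots> = U powr r * V powr r"
      by (simp add: powr_mult nonneg)
    also have "\<dots> \<le> (2 powr (r - 1) * W1 * ((norm y)\<^sup>2) powr r)
        * (2 powr (r - 1) * W2 * ((norm x)\<^sup>2) powr r)"
      unfolding U_def V_def by (intro mult_mono bound1 bound2) (simp_all add: bound1)
    also have "\<dots> = (2 powr (r - 1))\<^sup>2 * (W1 * W2) * ((norm x)\<^sup>2 * (norm y)\<^sup>2) powr r"
      by (simp add: powr_mult power2_eq_square)
    \<comment> \<open>On the unit sphere the squared norms of the components are \<open>s\<close>
      and \<open>1 - s\<close>, and \<open>s (1 - s)\<close> is at most 1/4.\<close>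
    also have "\<dots> \<le> (2 powr (r - 1))\<^sup>2 * (W1 * W2) * (1 / 4) powr r"
    proof (intro mult_left_mono powr_mono2)
      have "(norm x)\<^sup>2 + (norm y)\<^sup>2 = 1"
        using that by (simp add: z norm_prod_def)
      then have y: "(norm y)\<^sup>2 = 1 - (norm x)\<^sup>2" by simp
      have "s * (1 - s) \<le> 1 / 4" for s :: real
        using zero_le_power2[of "s - 1 / 2"] by (simp add: power2_eq_square algebra_simps)
      then show "(norm x)\<^sup>2 * (norm y)\<^sup>2 \<le> 1 / 4"
        unfolding y .
    qed (use r bound1(1) bound2(1) in auto)
    also have "\<dots> = W1 * W2 * (1 / 4)"
    proof -
      have "(2 powr (r - 1))\<^sup>2 = 4 powr (r - 1)"
        by (simp add: power2_eq_square powr_mult[symmetric])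
      then have "(2 powr (r - 1))\<^sup>2 * (1 / 4) powr r = 4 powr (r - 1) * (1 / 4) powr r"
        by simp
      also have "\<dots> = 1 / 4"
        by (simp add: powr_divide powr_diff)
      finally have "(2 powr (r - 1))\<^sup>2 * (1 / 4) powr r = 1 / 4" .
      then show ?thesis by (metis mult.assoc mult.commute)
    qed
    \<comment> \<open>After squaring, the constant obtained is 1/4, that is 1/2 for
      \<open>L powr r\<close>. As \<open>r >= 1\<close>, it is at most
      \<open>2 powr (r - 2)\<close>, with equality at \<open>r = 1\<close>.\<close>
    also have "\<dots> \<le> W1 * W2 * (2 powr (r - 2))\<^sup>2"
    proof (rule mult_left_mono)
      have "2 powr (- 1) \<le> 2 powr (r - 2)" using r by (intro powr_mono) auto
      then have "(1 / 2)\<^sup>2 \<le> (2 powr (r - 2))\<^sup>2"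
        by (intro power_mono) (auto simp: powr_minus)
      then show "1 / 4 \<le> (2 powr (r - 2))\<^sup>2" by (simp add: power2_eq_square)
    qed (simp add: bound1 bound2)
    also have "\<dots> = R\<^sup>2"
      using bound1(1) bound2(1)
      by (simp add: R_def power_mult_distrib powr_half_sqrt)
    finally have "(L powr r)\<^sup>2 \<le> R\<^sup>2"
      using nonneg by (simp add: power2_eq_square powr_mult)
    then show ?thesis
      unfolding L_def by (rule power2_le_imp_le[OF _ \<open>0 \<le> R\<close>])
  qed
  define N where "N = insert 0 {cmod (cinner (?T z) z) | z. norm z = 1}"
  \<comment> \<open>The pointwise bound is converted by an r-th root into a bound on the elements
    themselves, so that it passes to the supremum. The inserted 0 is covered by non-negativity of
    \<open>powr\<close>.\<close>
  have N_le: "v \<le> R powr (1 / r)" if "v \<in> N" for v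
  proof -
    consider "v = 0" | z where "norm z = 1" "v = cmod (cinner (?T z) z)"
      using \<open>v \<in> N\<close> unfolding N_def by auto
    then show ?thesis
    proof cases
      case 2
      then have "(v powr r) powr (1 / r) \<le> R powr (1 / r)"
        using unit r by (intro powr_mono2) auto
      then show ?thesis using 2 r by (simp add: powr_powr)
    qed simp
  qed
  have radius: "numerical_radius ?T = Sup N"
    by (simp add: numerical_radius_def N_def)
  have "0 \<le> numerical_radius ?T"
    unfolding radius by (rule cSup_upper[OF _ bdd_aboveI[OF N_le]]) (simp add: N_def)
  moreover have "numerical_radius ?T \<le> R powr (1 / r)"
    unfolding radius by (rule cSup_least[OF _ N_le]) (simp add: N_def)
  ultimately have "numerical_radius ?T powr r \<le> (R powr (1 / r)) powr r"
    using r by (intro powr_mono2) auto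
  also have "\<dots> = R"
    using r \<open>0 \<le> R\<close> by (simp add: powr_powr)
  finally show ?thesis
    by (simp add: R_def W1_def W2_def)
qed

end
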